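(* Let $f(q):=\log^* q\cdot \log^*\log q$. Then for every badly approximable real number $\theta$, $$\dim\big(\mathrm{Mad}_P(f)\cap\mathrm{Mad}_L(f)\cap \mathcal{L}_\theta\big)=1,$$ where $\dim$ is Hausdorff dimension, $\mathcal{L}_\theta=\{(\theta,y):y\in\mathbb{R}\}$ is the vertical line through $(\theta,0)$, and $$\mathrm{Mad}_P(f):=\Big\{(\alpha,\beta)\in\mathbb{R}^2:\ \liminf_{q\to\infty} f(q)\cdot q\cdot\|q\alpha\|\cdot\|q\beta\|>0\Big\},$$ $$\mathrm{Mad}_L(f):=\Big\{(\alpha,\beta)\in\mathbb{R}^2:\ \liminf_{|AB|\to\infty} f(|A|^*|B|^* )\cdot|A|^*|B|^*\cdot\|A\alpha-B\beta\|>0\Big\},$$ the second $\liminf$ taken over $(A,B)\in\mathbb{Z}^2$ with $|AB|\to\infty$.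
   Context: $\|x\|$ denotes the distance from $x$ to the nearest integer, $|x|^*:=\max\{|x|,1\}$, and $\log^* x:=1$ for $x<e$, $\log^*x:=\log x$ for $x\ge e$. A real $\theta$ is badly approximable if $\liminf_{q\to\infty} q\|q\theta\|>0$. *)

theory Defs
  imports "HOL-Analysis.Analysis"
begin

text \<open>
  The summand \<open>(diam U)\<^sup>s\<close> of the Hausdorff premeasure, with the conventions \<open>(diam \<emptyset>)\<^sup>s = 0\<close>
  and \<open>(diam U)\<^sup>0 = 1\<close> for nonempty \<open>U\<close>. The second one needs a case distinction because
  \<^term>\<open>0 powr 0 = (0::real)\<close>.
\<close>

definition hausdorff_gauge :: "real \<Rightarrow> 'a::metric_space set \<Rightarrow> ennreal" where
  "hausdorff_gauge s U =
    (if U = {} then 0 else if s = 0 then 1 else ennreal (diameter U powr s))"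

text \<open>
  Boundedness of the covering sets is required explicitly, since \<^const>\<open>diameter\<close> carries no
  information on unbounded sets. Finite covers are included, as the \<open>U i\<close> may be empty.
\<close>

definition hausdorff_premeasure :: "real \<Rightarrow> real \<Rightarrow> 'a::metric_space set \<Rightarrow> ennreal" where
  "hausdorff_premeasure s \<delta> E =
    Inf {(\<Sum>i. hausdorff_gauge s (U i)) | U :: nat \<Rightarrow> 'a set.
           E \<subseteq> (\<Union>i. U i) \<and> (\<forall>i. bounded (U i) \<and> diameter (U i) \<le> \<delta>)}"

definition hausdorff_measure :: "real \<Rightarrow> 'a::metric_space set \<Rightarrow> ennreal" where
  "hausdorff_measure s E = (SUP \<delta>\<in>{0<..}. hausdorff_premeasure s \<delta> E)"

definition hausdorff_dim :: "'a::metric_space set \<Rightarrow> ennreal" where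
  "hausdorff_dim E = Inf {ennreal s | s. 0 \<le> s \<and> hausdorff_measure s E = 0}"

definition int_dist :: "real \<Rightarrow> real" where
  "int_dist x = \<bar>x - of_int (round x)\<bar>"

definition abs_star :: "real \<Rightarrow> real" where
  "abs_star x = max \<bar>x\<bar> 1"

definition log_star :: "real \<Rightarrow> real" where
  "log_star x = (if x < exp 1 then 1 else ln x)"

definition badly_approximable :: "real \<Rightarrow> bool" where
  "badly_approximable \<theta> \<longleftrightarrow>
    liminf (\<lambda>q::nat. ereal (real q * int_dist (real q * \<theta>))) > 0"

definition Mad_P :: "(real \<Rightarrow> real) \<Rightarrow> (real \<times> real) set" where
  "Mad_P f = {(\<alpha>, \<beta>).
    liminf (\<lambda>q::nat. ereal (f (real q) * real q *
      int_dist (real q * \<alpha>) * int_dist (real q * \<beta>))) > 0}"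

text \<open>The filter of the limit \<open>\<bar>A B\<bar> \<rightarrow> \<infinity>\<close> over pairs of integers.\<close>

definition prod_at_infinity :: "(int \<times> int) filter" where
  "prod_at_infinity = filtercomap (\<lambda>(A, B). \<bar>A * B\<bar>) at_top"

definition Mad_L :: "(real \<Rightarrow> real) \<Rightarrow> (real \<times> real) set" where
  "Mad_L f = {(\<alpha>, \<beta>).
    Liminf prod_at_infinity (\<lambda>(A, B).
      ereal (f (abs_star (of_int A) * abs_star (of_int B)) *
        (abs_star (of_int A) * abs_star (of_int B)) *
        int_dist (of_int A * \<alpha> - of_int B * \<beta>))) > 0}"

definition vertical_line :: "real \<Rightarrow> (real \<times> real) set" where
  "vertical_line \<theta> = {(\<theta>, y) | y. True}"

end

theory Submission
  imports Defs
begin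

text \<open>
  On the line over \<open>\<theta>\<close>, a rational point \<open>(r/q, p/q)\<close> endangers the \<open>y\<close> within \<open>c / (f(q) q\<^sup>2 \<parallel>q\<theta>\<parallel>)\<close> of \<open>p/q\<close>, and a
  rational line \<open>A x - B y + C = 0\<close> endangers the \<open>y\<close> within \<open>c / (f(\<bar>AB\<bar>) \<bar>A\<bar>\<^sup>* B\<^sup>2)\<close> of \<open>(A \<theta> + C)/B\<close>. Consider the
  points (or lines) of height about \<open>T\<close> with \<open>q\<close> (or \<open>B\<close>) in a fixed dyadic range that are dangerous near an
  interval of length \<open>l\<close>. They correspond to integer vectors in a box of volume about \<open>T l\<close>, so there
  are only \<open>O(T l)\<close> of them unless too many lie in one plane. In that case the normal vector of
  the plane is a short dual vector, that is, a line (or point) of much smaller height whose danger set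
  meets the interval; this cannot happen if the earlier danger sets have been avoided. Summing over
  the dyadic ranges, the danger sets of level \<open>i\<close> cover a proportion \<open>O(\<epsilon> / log i)\<close> of every surviving interval that
  is longer than them by a factor polynomial in \<open>i\<close>.

  A point avoiding everything is found by repeated halving: always pass to the half on which a
  weighted sum of indicator functions of the danger sets has the smaller integral. Since a danger set
  is active for \<open>O(log i)\<close> steps only, its weight may decrease by a factor \<open>1 - const / log i\<close> per step,
  which pays for the sets that become active. A countable cover with small sum of
  \<open>diam\<^sup>s\<close>, where \<open>s < 1\<close>, can be included among the sets to be avoided. Hence no such cover exists, and the
  \<open>s\<close>-dimensional Hausdorff measure is positive.
\<close>

section \<open>Counting planar points that span no small triangles\<close>

lemma separated_card_le_range:
  fixes T :: "real set"
  assumes "finite T" "T \<noteq> {}"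
    and "\<And>a b. a \<in> T \<Longrightarrow> b \<in> T \<Longrightarrow> a < b \<Longrightarrow> g \<le> b - a"
  shows "(real (card T) - 1) * g \<le> Max T - Min T"
  using assms
proof (induction T rule: finite_linorder_max_induct)
  case empty
  then show ?case by simp
next
  case (insert b A)
  show ?case
  proof (cases "A = {}")
    case True
    then show ?thesis by simp
  next
    case False
    have bA: "b \<notin> A" using insert by auto
    have Mx: "Max A \<in> A" using insert False by simp
    then have lt: "Max A < b" using insert by auto
    have "Min A \<in> A" using insert False by simp
    then have "Min A < b" using insert by auto
    then have mn: "Min (insert b A) = Min A" using insert False by (simp add: Min_insert)
    have mx: "Max (insert b A) = b" using insert False lt by (simp add: Max_insert)
    have "g \<le> b - Max A" using insert.prems(2)[of "Max A" b] Mx lt by simp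
    moreover have "(real (card A) - 1) * g \<le> Max A - Min A"
      using insert False by blast
    moreover have "card (insert b A) = Suc (card A)" using bA insert by simp
    ultimately show ?thesis unfolding mn mx by (simp add: algebra_simps)
  qed
qed

text \<open>The smallest gap is at most the average gap.\<close>

lemma close_pair_exists:
  fixes T :: "real set"
  assumes "finite T" "2 \<le> card T"
  shows "\<exists>a\<in>T. \<exists>b\<in>T. a < b \<and> (real (card T) - 1) * (b - a) \<le> Max T - Min T"
proof -
  define P where "P = {(a, b) \<in> T \<times> T. a < b}"
  have finP: "finite P" unfolding P_def using assms by (auto intro: finite_subset[of _ "T \<times> T"])
  obtain a b where "a \<in> T" "b \<in> T" "a \<noteq> b"
    using assms by (metis card_2_iff' ex_card subsetD)
  then have "(a, b) \<in> P \<or> (b, a) \<in> P" unfolding P_def by auto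
  then have neP: "P \<noteq> {}" by auto
  define g where "g = Min ((\<lambda>(a, b). b - a) ` P)"
  have "g \<in> (\<lambda>(a, b). b - a) ` P" unfolding g_def using finP neP by simp
  then obtain a b where ab: "a \<in> T" "b \<in> T" "a < b" "g = b - a" unfolding P_def by auto
  have "g \<le> d - c" if "c \<in> T" "d \<in> T" "c < d" for c d
    unfolding g_def by (rule Min_le) (use that finP in \<open>force simp: P_def\<close>)+
  then have "(real (card T) - 1) * g \<le> Max T - Min T"
    by (intro separated_card_le_range) (use assms in auto)
  then show ?thesis using ab by blast
qed

text \<open>
  A finite set of points in the plane with pairwise distinct ordinates is encoded as the set of
  ordinates \<open>z\<close> together with the abscissa function \<open>x\<close>.
\<close>

definition on_line :: "(real \<Rightarrow> real) \<Rightarrow> real set \<Rightarrow> bool" where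
  "on_line x T \<longleftrightarrow> (\<exists>\<alpha> \<beta>. \<forall>z\<in>T. x z = \<alpha> + \<beta> * z)"

text \<open>Twice the signed area of the triangle with vertices \<open>(x a, a)\<close>,
  \<open>(x b, b)\<close>, \<open>(x c, c)\<close>.\<close>

definition tri_det :: "(real \<Rightarrow> real) \<Rightarrow> real \<Rightarrow> real \<Rightarrow> real \<Rightarrow> real" where
  "tri_det x a b c = (x b - x a) * (c - a) - (x c - x a) * (b - a)"

lemma on_line_pair:
  assumes "a \<noteq> b"
  shows "on_line x {a, b}"
proof -
  define \<beta> where "\<beta> = (x b - x a) / (b - a)"
  have "\<beta> * (b - a) = x b - x a" unfolding \<beta>_def using assms by simp
  then have "x a = (x a - \<beta> * a) + \<beta> * a" "x b = (x a - \<beta> * a) + \<beta> * b"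
    by (auto simp: algebra_simps)
  then show ?thesis unfolding on_line_def by blast
qed

text \<open>
  The points are cut greedily, from bottom to top, into maximal collinear runs. A run together with
  the next point spans a triangle that is subdivided by the points of the run, and the heights
  of these triangles add up.
\<close>

lemma card_le_if_triangles_large:
  fixes S :: "real set" and x :: "real \<Rightarrow> real"
  assumes "finite S" "S \<noteq> {}" "0 < \<eta>"
    and "\<And>z. z \<in> S \<Longrightarrow> \<bar>x z\<bar> \<le> \<xi>"
    and "\<And>a b c. a \<in> S \<Longrightarrow> b \<in> S \<Longrightarrow> c \<in> S \<Longrightarrow> tri_det x a b c = 0 \<or> \<eta> \<le> \<bar>tri_det x a b c\<bar>"
    and "\<And>T. T \<subseteq> S \<Longrightarrow> on_line x T \<Longrightarrow> real (card T) \<le> K"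
  shows "real (card S) \<le> 8 * \<xi> / \<eta> * (Max S - Min S) + K"
  using assms
proof (induction "card S" arbitrary: S rule: less_induct)
  case less
  note fin = less.prems(1) and ne = less.prems(2) and xb = less.prems(4) and det = less.prems(5)
  have xi0: "0 \<le> \<xi>" using xb ne by (meson abs_ge_zero all_not_in_conv order_trans)
  have range0: "Min S \<le> Max S" using fin ne by simp
  show ?case
  proof (cases "on_line x S")
    case True
    have "0 \<le> 8 * \<xi> / \<eta> * (Max S - Min S)" using xi0 range0 less.prems(3) by simp
    then show ?thesis using less.prems(6)[of S] True by simp
  next
    case False
    \<comment> \<open>Candidates for the lowest run: the collinear initial segments of
      \<open>S\<close>. A largest one, \<open>T\<close>, cannot be prolonged by the next point
      \<open>z'\<close>.\<close>
    define F where "F = {T. T \<subseteq> S \<and> on_line x T \<and> (\<forall>z\<in>T. \<forall>z'\<in>S - T. z < z')}"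
    have finF: "finite F" unfolding F_def by (rule finite_subset[of _ "Pow S"]) (use fin in auto)
    have "{} \<in> F" unfolding F_def by (auto simp: on_line_def)
    then obtain T where T: "T \<in> F" and Tmax: "\<And>T'. T' \<in> F \<Longrightarrow> card T' \<le> card T"
      using Max_in[of "card ` F"] Max_ge[of "card ` F"] finF by fastforce
    have TS: "T \<subseteq> S" and Tl: "on_line x T" and Tlow: "\<And>z z'. z \<in> T \<Longrightarrow> z' \<in> S - T \<Longrightarrow> z < z'"
      using T unfolding F_def by auto
    have finT: "finite T" using TS fin finite_subset by blast
    have neST: "S - T \<noteq> {}" using False Tl TS by auto
    define z' where "z' = Min (S - T)"
    have z': "z' \<in> S - T" unfolding z'_def using fin neST by (metis Min_in finite_Diff)
    have z'min: "z' \<le> z" if "z \<in> S - T" for z unfolding z'_def using fin that by simp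
    have nl: "\<not> on_line x (insert z' T)"
    proof
      assume "on_line x (insert z' T)"
      moreover have "z < w" if "z \<in> insert z' T" "w \<in> S - insert z' T" for z w
        using that Tlow z'min[of w] z' by (cases "z = z'") (auto simp: less_le)
      ultimately have "insert z' T \<in> F" unfolding F_def using TS z' by auto
      then have "card (insert z' T) \<le> card T" by (rule Tmax)
      then show False using z' finT by simp
    qed
    have cardT: "2 \<le> card T"
    proof (rule ccontr)
      assume "\<not> 2 \<le> card T"
      then have "card T = 0 \<or> card T = 1" by auto
      then have "T = {} \<or> (\<exists>t. T = {t})" using finT card_1_singletonE by auto
      moreover have "on_line x {z'}" unfolding on_line_def by (intro exI[of _ "x z'"] exI[of _ 0]) auto
      ultimately show False using nl z' on_line_pair[of z'] by auto
    qed
    then have neT: "T \<noteq> {}" by auto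
    define a where "a = Min T"
    define b where "b = Max T"
    have a: "a \<in> T" and b: "b \<in> T" unfolding a_def b_def using finT neT by auto
    have ab: "a \<le> b" unfolding b_def using a finT by simp
    have bz: "b < z'" using Tlow b z' by blast
    obtain \<alpha> \<beta> where line: "\<And>z. z \<in> T \<Longrightarrow> x z = \<alpha> + \<beta> * z" using Tl unfolding on_line_def by blast
    \<comment> \<open>Signed horizontal distance of the point with ordinate \<open>z'\<close> from
      the line of \<open>T\<close>. A triangle formed by this point and two points of
      \<open>T\<close> has area proportional to the gap of these two, so the lower bound on areas
      keeps the gaps large.\<close>
    define h where "h = x z' - \<alpha> - \<beta> * z'"
    have h0: "h \<noteq> 0"
    proof
      assume "h = 0"
      then have "x z' = \<alpha> + \<beta> * z'" unfolding h_def by simp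
      then have "on_line x (insert z' T)" unfolding on_line_def using line by blast
      then show False using nl by simp
    qed
    have D: "tri_det x c d z' = - h * (d - c)" if "c \<in> T" "d \<in> T" for c d
      unfolding tri_det_def h_def line[OF that(1)] line[OF that(2)] by (simp add: algebra_simps)
    have gap: "\<eta> / \<bar>h\<bar> \<le> d - c" if "c \<in> T" "d \<in> T" "c < d" for c d
    proof -
      have "tri_det x c d z' \<noteq> 0" using D[OF that(1,2)] h0 that by simp
      then have "\<eta> \<le> \<bar>tri_det x c d z'\<bar>" using det[of c d z'] that TS z' by blast
      also have "\<dots> = \<bar>h\<bar> * (d - c)" using D[OF that(1,2)] that by (simp add: abs_mult)
      finally show ?thesis using h0 by (simp add: field_simps)
    qed
    have "(real (card T) - 1) * (\<eta> / \<bar>h\<bar>) \<le> b - a"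
      unfolding a_def b_def using separated_card_le_range[OF finT neT gap] by simp
    then have "(real (card T) - 1) * \<eta> \<le> \<bar>h\<bar> * (b - a)" using h0 by (simp add: field_simps)
    also have "\<dots> = \<bar>tri_det x a b z'\<bar>" using D[OF a b] ab by (simp add: abs_mult)
    also have "\<dots> \<le> \<bar>x b - x a\<bar> * (z' - a) + \<bar>x z' - x a\<bar> * (b - a)"
      unfolding tri_det_def using ab bz
      by (intro order_trans[OF abs_triangle_ineq4]) (simp add: abs_mult)
    also have "\<dots> \<le> (2 * \<xi>) * (z' - a) + (2 * \<xi>) * (z' - a)"
    proof (intro add_mono mult_mono)
      have "\<bar>x a\<bar> \<le> \<xi>" "\<bar>x b\<bar> \<le> \<xi>" "\<bar>x z'\<bar> \<le> \<xi>" using xb a b z' TS by auto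
      then show "\<bar>x b - x a\<bar> \<le> 2 * \<xi>" "\<bar>x z' - x a\<bar> \<le> 2 * \<xi>" by auto
    qed (use ab bz xi0 in auto)
    finally have "(real (card T) - 1) * \<eta> \<le> 4 * \<xi> * (z' - a)" by simp
    \<comment> \<open>As \<open>T\<close> has at least two points, \<open>card T\<close> is at most
      twice the number of its gaps.\<close>
    moreover have "real (card T) * \<eta> \<le> 2 * (real (card T) - 1) * \<eta>"
      using cardT less.prems(3) by (intro mult_right_mono) auto
    ultimately have "real (card T) * \<eta> \<le> 8 * \<xi> * (z' - a)" by linarith
    then have cT: "real (card T) \<le> 8 * \<xi> / \<eta> * (z' - a)"
      using less.prems(3) by (simp add: pos_le_divide_eq)
    have cS: "card S = card T + card (S - T)"
      using TS fin finT by (metis card_Diff_subset card_mono le_add_diff_inverse)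
    have "real (card (S - T)) \<le> 8 * \<xi> / \<eta> * (Max (S - T) - Min (S - T)) + K"
    proof (rule less.hyps)
      show "card (S - T) < card S" using cS cardT by simp
      fix T' assume "T' \<subseteq> S - T" "on_line x T'"
      then show "real (card T') \<le> K" using less.prems(6)[of T'] by blast
    qed (use neST fin less.prems(3) xb det in auto)
    moreover have "Max (S - T) \<le> Max S" using fin neST by (intro Max_mono) auto
    moreover have "a \<ge> Min S" using a TS fin by (intro Min_le) auto
    ultimately have "real (card (S - T)) \<le> 8 * \<xi> / \<eta> * (Max S - z') + K"
      unfolding z'_def[symmetric] using xi0 less.prems(3)
      by (smt (verit, best) divide_nonneg_pos mult_left_mono zero_le_mult_iff)
    \<comment> \<open>The run \<open>T\<close> is charged to the strip between the ordinates
      \<open>a\<close> and \<open>z'\<close>, all other points to the strip above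
      \<open>z'\<close>.\<close>
    then have "real (card S) \<le> 8 * \<xi> / \<eta> * ((z' - a) + (Max S - z')) + K"
      unfolding cS distrib_left using cT by simp
    also have "(z' - a) + (Max S - z') = Max S - a" by simp
    also have "8 * \<xi> / \<eta> * (Max S - a) + K \<le> 8 * \<xi> / \<eta> * (Max S - Min S) + K"
      using \<open>a \<ge> Min S\<close> xi0 less.prems(3) by (intro add_right_mono mult_left_mono) auto
    finally show ?thesis .
  qed
qed

text \<open>On a line the abscissa is affine in the ordinate, so the pair that is closest in one
  coordinate is closest in the other as well.\<close>

lemma close_pair_on_line:
  fixes T :: "real set"
  assumes "finite T" "2 \<le> card T" "on_line x T"
    and "\<And>z. z \<in> T \<Longrightarrow> \<bar>x z\<bar> \<le> \<xi>"
    and "\<And>z. z \<in> T \<Longrightarrow> \<bar>z - y\<bar> \<le> l"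
  shows "\<exists>a\<in>T. \<exists>b\<in>T. a < b \<and> b - a \<le> 2 * l / (real (card T) - 1)
    \<and> \<bar>x b - x a\<bar> \<le> 2 * \<xi> / (real (card T) - 1)"
proof -
  obtain a b where ab: "a \<in> T" "b \<in> T" "a < b"
    and gap: "(real (card T) - 1) * (b - a) \<le> Max T - Min T"
    using close_pair_exists[OF assms(1,2)] by blast
  have neT: "T \<noteq> {}" using ab by auto
  have M: "Max T \<in> T" "Min T \<in> T" using neT assms(1) by auto
  have c1: "0 < real (card T) - 1" using assms(2) by simp
  obtain \<alpha> \<beta> where line: "\<And>z. z \<in> T \<Longrightarrow> x z = \<alpha> + \<beta> * z"
    using assms(3) unfolding on_line_def by blast
  have "Max T - Min T \<le> 2 * l" using assms(5)[OF M(1)] assms(5)[OF M(2)] by linarith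
  then have "(real (card T) - 1) * (b - a) \<le> 2 * l" using gap by linarith
  then have 1: "b - a \<le> 2 * l / (real (card T) - 1)" using c1 by (simp add: field_simps)
  have "(real (card T) - 1) * \<bar>x b - x a\<bar> = \<bar>\<beta>\<bar> * ((real (card T) - 1) * (b - a))"
    unfolding line[OF ab(1)] line[OF ab(2)] using ab
    by (simp add: abs_mult right_diff_distrib[symmetric])
  also have "\<dots> \<le> \<bar>\<beta>\<bar> * (Max T - Min T)" using gap by (intro mult_left_mono) auto
  also have "\<dots> = \<bar>x (Max T) - x (Min T)\<bar>"
    unfolding line[OF M(1)] line[OF M(2)] using M assms(1) ab
    by (simp add: abs_mult right_diff_distrib[symmetric])
  also have "\<dots> \<le> 2 * \<xi>" using assms(4)[OF M(1)] assms(4)[OF M(2)] by linarith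
  finally have "\<bar>x b - x a\<bar> \<le> 2 * \<xi> / (real (card T) - 1)" using c1 by (simp add: field_simps)
  then show ?thesis using ab 1 by blast
qed

text \<open>
  The excluded pairs are those whose cross product, in the coordinates dual to
  \<open>(w, w x, w (z - y))\<close>, is short.
\<close>

lemma card_le_if_no_short_cross_product:
  fixes S :: "real set" and w x :: "real \<Rightarrow> real"
  assumes "finite S" "0 < Q" "0 < l" "0 < T" "0 < \<tau>"
    and w: "\<And>z. z \<in> S \<Longrightarrow> Q \<le> w z \<and> w z < 2 * Q"
    and x: "\<And>z. z \<in> S \<Longrightarrow> \<bar>x z\<bar> \<le> 8 * T / Q ^ 3"
    and near: "\<And>z. z \<in> S \<Longrightarrow> \<bar>z - y\<bar> \<le> l"
    and int: "\<And>a b c. a \<in> S \<Longrightarrow> b \<in> S \<Longrightarrow> c \<in> S \<Longrightarrow> w a * w b * w c * tri_det x a b c \<in> \<int>"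
    and no: "\<And>a b. a \<in> S \<Longrightarrow> b \<in> S \<Longrightarrow> a < b \<Longrightarrow>
      w a * w b * (b - a) \<le> 8 * \<tau> * Q\<^sup>2 / T \<Longrightarrow>
      \<bar>w a * w b * (x b - x a)\<bar> \<le> 64 * \<tau> / (Q * l) \<Longrightarrow>
      \<bar>w a * w b * (x a * (b - y) - x b * (a - y))\<bar> \<le> 128 * \<tau> / Q \<Longrightarrow> False"
  shows "real (card S) \<le> (1024 + 1 / \<tau>) * (T * l) + 1"
proof (cases "S = {}")
  case True
  then show ?thesis using assms by simp
next
  case ne: False
  define \<xi> where "\<xi> = 8 * T / Q ^ 3"
  \<comment> \<open>A nonzero determinant becomes a nonzero integer when multiplied by
    \<open>w a * w b * w c\<close>, and this product is at most \<open>8 * Q ^ 3\<close>.\<close>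
  define \<eta> where "\<eta> = 1 / (8 * Q ^ 3)"
  have xi0: "0 < \<xi>" and eta0: "0 < \<eta>" unfolding \<xi>_def \<eta>_def using assms by auto
  have ww: "0 \<le> w a * w b \<and> w a * w b \<le> 4 * Q\<^sup>2" if "a \<in> S" "b \<in> S" for a b
  proof -
    have "w a * w b \<le> (2 * Q) * (2 * Q)"
      using w[OF that(1)] w[OF that(2)] assms(2) by (intro mult_mono) auto
    moreover have "0 \<le> w a * w b" using w[OF that(1)] w[OF that(2)] assms(2) by simp
    ultimately show ?thesis by (simp add: power2_eq_square)
  qed
  have "real (card S) \<le> 8 * \<xi> / \<eta> * (Max S - Min S) + (T * l / \<tau> + 1)"
  proof (rule card_le_if_triangles_large)
    fix a b c assume abc: "a \<in> S" "b \<in> S" "c \<in> S"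
    show "tri_det x a b c = 0 \<or> \<eta> \<le> \<bar>tri_det x a b c\<bar>"
    proof (cases "tri_det x a b c = 0")
      case False
      have pos: "0 < w a * w b * w c" using w abc assms(2) by (smt (verit) mult_pos_pos)
      have "w a * w b * w c \<le> 4 * Q\<^sup>2 * (2 * Q)"
        using ww[OF abc(1,2)] w[OF abc(3)] assms(2) by (intro mult_mono[of "w a * w b"]) auto
      then have le: "w a * w b * w c \<le> 8 * Q ^ 3" by (simp add: power2_eq_square power3_eq_cube)
      have "1 \<le> \<bar>w a * w b * w c * tri_det x a b c\<bar>"
        using int[OF abc] False pos Ints_nonzero_abs_ge1 by (metis less_irrefl mult_eq_0_iff)
      also have "\<dots> = w a * w b * w c * \<bar>tri_det x a b c\<bar>"
        unfolding abs_mult[of "w a * w b * w c"] abs_of_pos[OF pos] ..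
      also have "\<dots> \<le> 8 * Q ^ 3 * \<bar>tri_det x a b c\<bar>" using le by (intro mult_right_mono) auto
      finally have "\<eta> \<le> \<bar>tri_det x a b c\<bar>"
        unfolding \<eta>_def using assms(2) by (simp add: field_simps)
      then show ?thesis by simp
    qed simp
  next
    fix U assume U: "U \<subseteq> S" "on_line x U"
    show "real (card U) \<le> T * l / \<tau> + 1"
    proof (rule ccontr)
      assume large: "\<not> real (card U) \<le> T * l / \<tau> + 1"
      define M where "M = real (card U) - 1"
      have M: "T * l / \<tau> < M" using large unfolding M_def by simp
      have M0: "0 < T * l / \<tau>" using assms by simp
      have iM: "1 / M \<le> \<tau> / (T * l)"
        using le_imp_inverse_le[OF less_imp_le[OF M] M0] by (simp add: inverse_eq_divide)
      have Tl: "0 < T * l" using assms by simp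
      have fU: "finite U" using U assms finite_subset by blast
      have "2 \<le> card U" using M M0 unfolding M_def by linarith
      \<comment> \<open>Too many points on one line contain two so close together that their cross
        product is short, contrary to \<open>no\<close>.\<close>
      then obtain a b where ab: "a \<in> U" "b \<in> U" "a < b"
        and g1: "b - a \<le> 2 * l / M" and g2: "\<bar>x b - x a\<bar> \<le> 2 * \<xi> / M"
        using close_pair_on_line[OF fU _ U(2), of \<xi> y l] x near U(1) unfolding \<xi>_def M_def by blast
      have abS: "a \<in> S" "b \<in> S" using ab U by auto
      note W = ww[OF abS]
      have g1': "b - a \<le> 2 * \<tau> / T"
      proof -
        have "2 * l / M = 2 * l * (1 / M)" by simp
        also have "\<dots> \<le> 2 * l * (\<tau> / (T * l))" using iM assms by (intro mult_left_mono) auto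
        also have "\<dots> = 2 * \<tau> / T" using assms by simp
        finally show ?thesis using g1 by simp
      qed
      have g2': "\<bar>x b - x a\<bar> \<le> 16 * \<tau> / (Q ^ 3 * l)"
      proof -
        have "2 * \<xi> / M = 2 * \<xi> * (1 / M)" by simp
        also have "\<dots> \<le> 2 * \<xi> * (\<tau> / (T * l))" using iM xi0 by (intro mult_left_mono) auto
        also have "\<dots> = 16 * \<tau> / (Q ^ 3 * l)" using assms unfolding \<xi>_def by (simp add: field_simps)
        finally show ?thesis using g2 by simp
      qed
      have "w a * w b * (b - a) \<le> 4 * Q\<^sup>2 * (2 * \<tau> / T)"
        using W g1' ab by (intro mult_mono[of "w a * w b"]) auto
      then have 1: "w a * w b * (b - a) \<le> 8 * \<tau> * Q\<^sup>2 / T" by (simp add: field_simps)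
      have "\<bar>w a * w b * (x b - x a)\<bar> = w a * w b * \<bar>x b - x a\<bar>" 
        unfolding abs_mult[of "w a * w b"] using W by simp
      also have "\<dots> \<le> 4 * Q\<^sup>2 * (16 * \<tau> / (Q ^ 3 * l))" using W g2' by (intro mult_mono[of "w a * w b"]) auto
      also have "\<dots> = 64 * \<tau> / (Q * l)"
        using assms by (simp add: field_simps power2_eq_square power3_eq_cube)
      finally have 2: "\<bar>w a * w b * (x b - x a)\<bar> \<le> 64 * \<tau> / (Q * l)" .
      \<comment> \<open>Rewritten so that each term contains a difference already known to be
        small.\<close>
      have "x a * (b - y) - x b * (a - y) = x a * (b - a) - (a - y) * (x b - x a)"
        by (simp add: algebra_simps)
      then have "\<bar>x a * (b - y) - x b * (a - y)\<bar> \<le> \<bar>x a\<bar> * (b - a) + \<bar>a - y\<bar> * \<bar>x b - x a\<bar>"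
        using ab abs_triangle_ineq4[of "x a * (b - a)" "(a - y) * (x b - x a)"] by (simp add: abs_mult)
      also have "\<dots> \<le> \<xi> * (2 * \<tau> / T) + l * (16 * \<tau> / (Q ^ 3 * l))"
        using x[OF abS(1)] near[OF abS(1)] g1' g2' ab xi0 assms(3) unfolding \<xi>_def[symmetric]
        by (intro add_mono mult_mono) auto
      also have "\<dots> = 32 * \<tau> / Q ^ 3" unfolding \<xi>_def using assms by (simp add: field_simps)
      finally have g3: "\<bar>x a * (b - y) - x b * (a - y)\<bar> \<le> 32 * \<tau> / Q ^ 3" .
      have "\<bar>w a * w b * (x a * (b - y) - x b * (a - y))\<bar>
          = w a * w b * \<bar>x a * (b - y) - x b * (a - y)\<bar>" 
        unfolding abs_mult[of "w a * w b"] using W by simp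
      also have "\<dots> \<le> 4 * Q\<^sup>2 * (32 * \<tau> / Q ^ 3)" using W g3 by (intro mult_mono[of "w a * w b"]) auto
      also have "\<dots> = 128 * \<tau> / Q"
        using assms by (simp add: field_simps power2_eq_square power3_eq_cube)
      finally have 3: "\<bar>w a * w b * (x a * (b - y) - x b * (a - y))\<bar> \<le> 128 * \<tau> / Q" .
      show False using no[OF abS ab(3) 1 2 3] .
    qed
  qed (use assms ne eta0 in \<open>auto simp: \<xi>_def\<close>)
  also have "\<dots> \<le> 8 * \<xi> / \<eta> * (2 * l) + (T * l / \<tau> + 1)"
  proof -
    have "Max S \<in> S" "Min S \<in> S" using assms(1) ne by auto
    then have "Max S - Min S \<le> 2 * l" using near[of "Max S"] near[of "Min S"] by linarith
    then show ?thesis using xi0 eta0 by (intro add_right_mono mult_left_mono) auto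
  qed
  \<comment> \<open>With the factor \<open>2 * l\<close> this is the main term
    \<open>1024 * (T * l)\<close>.\<close>
  also have "8 * \<xi> / \<eta> = 512 * T" unfolding \<xi>_def \<eta>_def using assms(2) by simp
  finally show ?thesis by (simp add: algebra_simps)
qed

section \<open>Bad approximability and the scale of heights\<close>

lemma int_dist_le: "int_dist x \<le> \<bar>x - of_int m\<bar>"
  unfolding int_dist_def by (rule round_diff_minimal)

lemma int_dist_nonneg: "0 \<le> int_dist x"
  unfolding int_dist_def by simp

lemma int_dist_le_half: "int_dist x \<le> 1 / 2"
  unfolding int_dist_def using of_int_round_abs_le[of x] by (simp add: abs_minus_commute)

text \<open>The liminf controls large \<open>q\<close> only. At each of the finitely many others the
  value is positive: if it were zero, it would be zero at all multiples of \<open>q\<close>, also at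
  those beyond \<open>N\<close>. A minimum then gives a single constant.\<close>

lemma badly_approximable_uniform:
  fixes \<theta> :: real
  assumes "badly_approximable \<theta>"
  obtains \<gamma> where "0 < \<gamma>" "\<gamma> \<le> 1 / 2" "\<And>a c :: int. a \<noteq> 0 \<Longrightarrow> \<gamma> \<le> \<bar>real_of_int a\<bar> * \<bar>a * \<theta> - c\<bar>"
proof -
  let ?F = "\<lambda>q::nat. real q * int_dist (real q * \<theta>)"
  from assms obtain e where e: "0 < e" "e < liminf (\<lambda>q. ereal (?F q))"
    unfolding badly_approximable_def using dense by blast
  then have "eventually (\<lambda>q. e < ereal (?F q)) sequentially" by (metis less_LiminfD)
  moreover obtain d where d: "0 < d" "ereal d \<le> e"
    using e by (cases e) (auto intro: that[of 1])
  ultimately have "eventually (\<lambda>q. d < ?F q) sequentially"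
    by (auto elim!: eventually_mono) (meson ereal_less_le le_less_trans less_ereal.simps(1) not_le order_less_le_trans)
  then obtain N where N: "\<And>q. q \<ge> N \<Longrightarrow> d < ?F q" unfolding eventually_sequentially by blast
  have pos: "0 < ?F q" if "q \<ge> 1" for q
  proof (rule ccontr)
    assume "\<not> 0 < ?F q"
    then have "int_dist (real q * \<theta>) = 0"
      using that int_dist_nonneg[of "real q * \<theta>"] by (simp add: zero_less_mult_iff)
    then have eq: "real q * \<theta> = of_int (round (real q * \<theta>))" unfolding int_dist_def by simp
    have "real (q * (N + 1)) * \<theta> = of_int (round (real q * \<theta>) * (int N + 1))"
      using eq by (simp add: algebra_simps)
    then have "int_dist (real (q * (N + 1)) * \<theta>) \<le> 0"
      using int_dist_le[of "real (q * (N + 1)) * \<theta>" "round (real q * \<theta>) * (int N + 1)"] by simp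
    then have "?F (q * (N + 1)) \<le> 0"
      using mult_nonneg_nonpos[of "real (q * (N + 1))"] by simp
    moreover have "N \<le> q * (N + 1)" using that by (cases q) auto
    ultimately show False using N[of "q * (N + 1)"] d by linarith
  qed
  define \<gamma> where "\<gamma> = Min (insert d (?F ` {1..N}))"
  have g0: "0 < \<gamma>" unfolding \<gamma>_def using pos d by (subst Min_gr_iff) auto
  have gF: "\<gamma> \<le> ?F q" if "q \<ge> 1" for q
  proof (cases "q \<le> N")
    case True
    then show ?thesis unfolding \<gamma>_def using that by (intro Min_le) auto
  next
    case False
    have "\<gamma> \<le> d" unfolding \<gamma>_def by (intro Min_le) auto
    then show ?thesis using N[of q] False by simp
  qed
  show thesis
  proof
    show "0 < \<gamma>" by (rule g0)
    show "\<gamma> \<le> 1 / 2" using gF[of 1] int_dist_le_half[of \<theta>] by simp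
    fix a c :: int assume a: "a \<noteq> 0"
    have eq: "real (nat \<bar>a\<bar>) = \<bar>real_of_int a\<bar>" by simp
    have "\<gamma> \<le> \<bar>real_of_int a\<bar> * int_dist (\<bar>real_of_int a\<bar> * \<theta>)"
      using gF[of "nat \<bar>a\<bar>"] a unfolding eq by linarith
    \<comment> \<open>The factor \<open>sgn a\<close> turns an approximation of
      \<open>a * \<theta>\<close> by \<open>c\<close> into one of
      \<open>\<bar>a\<bar> * \<theta>\<close>.\<close>
    also have "int_dist (\<bar>real_of_int a\<bar> * \<theta>) \<le> \<bar>a * \<theta> - c\<bar>"
      using int_dist_le[of "\<bar>real_of_int a\<bar> * \<theta>" "sgn a * c"] a
      by (cases "a > 0") auto
    finally show "\<gamma> \<le> \<bar>real_of_int a\<bar> * \<bar>a * \<theta> - c\<bar>" by (simp add: mult_left_mono)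
  qed
qed

text \<open>
  Dangerous sets of level \<open>i\<close> have height between \<open>height_bd i\<close> and \<open>height_bd (Suc i)\<close> and are treated
  on intervals of length about \<open>2\<^sup>-\<^sup>i\<close>. The factor \<open>(i + 1)\<^sup>2\<close> is the delay: it makes these intervals longer
  than \<open>1 / height_bd i\<close> by a factor of at least \<open>growth i\<close>, which plays the role of \<open>f\<close>.
\<close>

definition height_bd :: "nat \<Rightarrow> real" where
  "height_bd i = 2 ^ i * (real i + 1)\<^sup>2"

text \<open>Stands for the iterated logarithm: the logarithm of a height of level \<open>i\<close>
  is roughly proportional to \<open>i\<close>. The summand \<open>1\<close> allows division by
  \<open>lam\<close> at every level.\<close>

definition lam :: "nat \<Rightarrow> real" where
  "lam i = 1 + ln (real i + 1)"

definition growth :: "nat \<Rightarrow> real" where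
  "growth i = (real i + 1) * lam i"

lemma height_bd_pos: "0 < height_bd i"
  unfolding height_bd_def by simp

lemma height_bd_0: "height_bd 0 = 1"
  unfolding height_bd_def by simp

lemma strict_mono_height_bd: "strict_mono height_bd"
proof (rule strict_mono_Suc_iff[THEN iffD2], rule allI)
  fix i
  have "2 ^ i * (real i + 1)\<^sup>2 < 2 ^ Suc i * (real (Suc i) + 1)\<^sup>2"
    by (intro mult_strict_mono power_strict_mono) auto
  then show "height_bd i < height_bd (Suc i)" unfolding height_bd_def .
qed

lemma height_bd_Suc_le: "height_bd (Suc i) \<le> 8 * height_bd i"
proof -
  have "(real (Suc i) + 1)\<^sup>2 \<le> (2 * (real i + 1))\<^sup>2" by (intro power_mono) auto
  then show ?thesis unfolding height_bd_def power_mult_distrib by simp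
qed

lemma power2_le_height_bd: "2 ^ i \<le> height_bd i"
  unfolding height_bd_def using mult_left_mono[of 1 "(real i + 1)\<^sup>2" "2 ^ i"] by simp

lemma height_bd_le_power: "height_bd i \<le> 2 ^ (3 * i)"
proof -
  have "real (i + 1) \<le> real (2 ^ i)" by (subst of_nat_le_iff) (induction i, auto)
  then have "(real i + 1)\<^sup>2 \<le> (2 ^ i)\<^sup>2" by (intro power_mono) auto
  then have "height_bd i \<le> 2 ^ i * (2 ^ i)\<^sup>2" unfolding height_bd_def by simp
  also have "\<dots> = 2 ^ (3 * i)" by (simp add: power2_eq_square power_mult power3_eq_cube power_mult_distrib[symmetric])
  finally show ?thesis .
qed

lemma height_bd_index:
  assumes "1 \<le> h"
  obtains i where "height_bd i \<le> h" "h < height_bd (Suc i)"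
proof -
  obtain n where "h < 2 ^ n" using real_arch_pow[of 2 h] by auto
  then have ex: "h < height_bd n" using power2_le_height_bd[of n] by linarith
  define m where "m = (LEAST n. h < height_bd n)"
  have m: "h < height_bd m" unfolding m_def using ex by (rule LeastI)
  have "m \<noteq> 0" using m assms height_bd_0 by (metis not_le)
  then obtain i where i: "m = Suc i" by (cases m) auto
  have "\<not> h < height_bd i" using not_less_Least[of i "\<lambda>n. h < height_bd n"] i unfolding m_def by auto
  then show thesis using that[of i] m i by simp
qed

lemma lam_ge_1: "1 \<le> lam i"
  unfolding lam_def by simp

lemma lam_mono: "i \<le> j \<Longrightarrow> lam i \<le> lam j"
  unfolding lam_def by simp

lemma growth_pos: "0 < growth i"
  unfolding growth_def using lam_ge_1[of i] by (intro mult_pos_pos) auto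

lemma growth_mono: "i \<le> j \<Longrightarrow> growth i \<le> growth j"
  unfolding growth_def using lam_ge_1[of i] lam_mono[of i j] by (intro mult_mono) auto

lemma growth_le_square: "growth i \<le> (real i + 1)\<^sup>2"
proof -
  have "lam i \<le> real i + 1" unfolding lam_def using ln_add_one_self_le_self[of "real i"] by (simp add: add.commute)
  then show ?thesis unfolding growth_def power2_eq_square by (intro mult_left_mono) auto
qed

section \<open>Danger sets of rational points and lines\<close>

locale bad_line =
  fixes \<theta> \<gamma> \<epsilon> :: real
  assumes gamma: "0 < \<gamma>" "\<gamma> \<le> 1 / 2"
    and bad: "\<And>a c :: int. a \<noteq> 0 \<Longrightarrow> \<gamma> \<le> \<bar>real_of_int a\<bar> * \<bar>a * \<theta> - c\<bar>"
    and eps: "0 < \<epsilon>" "\<epsilon> \<le> 1 / 4"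
begin

text \<open>
  The division by \<open>\<gamma>\<close> in \<open>point_height\<close> makes all heights at least \<open>1\<close>, so that every rational point and
  every rational line has a level.
\<close>

definition rho :: "nat \<Rightarrow> real" where
  "rho i = \<epsilon> / (growth i * height_bd i)"

definition point_height :: "int \<Rightarrow> real" where
  "point_height q = (real_of_int q)\<^sup>2 * int_dist (q * \<theta>) / \<gamma>"

definition line_height :: "int \<Rightarrow> int \<Rightarrow> real" where
  "line_height A B = abs_star A * (real_of_int B)\<^sup>2"

definition has_level :: "real \<Rightarrow> nat \<Rightarrow> bool" where
  "has_level h i \<longleftrightarrow> height_bd i \<le> h \<and> h < height_bd (Suc i)"

text \<open>Only the ordinate is recorded. The abscissa of the point is \<open>r / q\<close> with
  \<open>r\<close> the integer nearest to \<open>q * \<theta>\<close>; it enters through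
  \<open>point_height\<close>.\<close>

definition point_centres :: "nat \<Rightarrow> real set" where
  "point_centres i = {real_of_int p / q | p q :: int. 0 < q \<and> has_level (point_height q) i}"

definition line_centres :: "nat \<Rightarrow> real set" where
  "line_centres i = {(A * \<theta> + C) / B | A B C :: int. 0 < B \<and> has_level (line_height A B) i}"

text \<open>One radius serves a whole level, because the heights in it differ by a factor of at most
  8.\<close>

definition avoids :: "nat \<Rightarrow> real \<Rightarrow> bool" where
  "avoids i y \<longleftrightarrow> (\<forall>z\<in>point_centres i \<union> line_centres i. rho i \<le> \<bar>y - z\<bar>)"

lemma rho_pos: "0 < rho i"
  unfolding rho_def using eps growth_pos height_bd_pos by simp

text \<open>Bad approximability bounds \<open>q * int_dist (q * \<theta>)\<close> below by
  \<open>\<gamma>\<close>. Hence a bound on the height of a point bounds its denominator.\<close>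

lemma abs_le_point_height:
  assumes "q \<noteq> 0"
  shows "\<bar>real_of_int q\<bar> \<le> point_height q"
proof -
  have "\<gamma> \<le> \<bar>real_of_int q\<bar> * int_dist (q * \<theta>)"
    unfolding int_dist_def using bad[OF assms] by blast
  then have "\<bar>real_of_int q\<bar> * \<gamma> \<le> \<bar>real_of_int q\<bar> * (\<bar>real_of_int q\<bar> * int_dist (q * \<theta>))"
    by (rule mult_left_mono) simp
  then show ?thesis unfolding point_height_def using gamma by (simp add: field_simps power2_eq_square)
qed

lemma square_le_line_height: "(real_of_int B)\<^sup>2 \<le> line_height A B"
  unfolding line_height_def abs_star_def
  using mult_right_mono[of 1 "max \<bar>real_of_int A\<bar> 1" "(real_of_int B)\<^sup>2"] by simp

lemma int_square_ge_1: "B \<noteq> 0 \<Longrightarrow> 1 \<le> (real_of_int B)\<^sup>2" for B :: int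
  by (metis Ints_nonzero_abs_ge1 Ints_of_int of_int_eq_0_iff one_le_power power2_abs)

lemma line_height_ge_1: "B \<noteq> 0 \<Longrightarrow> 1 \<le> line_height A B"
  using square_le_line_height[of B A] int_square_ge_1[of B] by linarith

lemma point_height_ge_1: "q \<noteq> 0 \<Longrightarrow> 1 \<le> point_height q"
proof -
  assume "q \<noteq> 0"
  then have "1 \<le> \<bar>real_of_int q\<bar>" by linarith
  then show ?thesis using abs_le_point_height[OF \<open>q \<noteq> 0\<close>] by linarith
qed

lemma avoids_point:
  fixes y :: real and q p :: int
  assumes "has_level (point_height q) i" "avoids i y" "q \<noteq> 0"
  shows "rho i * \<bar>real_of_int q\<bar> \<le> \<bar>q * y - p\<bar>"
proof -
  \<comment> \<open>Centres have positive denominators; a negative \<open>q\<close> is replaced by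
    \<open>- q\<close>, which has the same height.\<close>
  have ev: "point_height (- q) = point_height q" for q
  proof -
    have le: "int_dist (- x) \<le> int_dist x" for x
      using int_dist_le[of "- x" "- round x"] unfolding int_dist_def[of x] by simp
    then have "int_dist (- x) = int_dist x" for x using le[of x] le[of "- x"] by (simp add: antisym)
    then show ?thesis unfolding point_height_def by simp
  qed
  have z: "real_of_int p / q \<in> point_centres i"
  proof (cases "q > 0")
    case True
    then show ?thesis unfolding point_centres_def using assms by blast
  next
    case False
    have "real_of_int p / q = real_of_int (- p) / real_of_int (- q)" by simp
    moreover have "0 < - q \<and> has_level (point_height (- q)) i" using assms False ev[of q] by auto
    ultimately show ?thesis unfolding point_centres_def by blast
  qed
  then have "rho i \<le> \<bar>y - real_of_int p / q\<bar>" using assms(2) unfolding avoids_def by blast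
  then have "rho i * \<bar>real_of_int q\<bar> \<le> \<bar>y - real_of_int p / q\<bar> * \<bar>real_of_int q\<bar>"
    by (intro mult_right_mono) auto
  also have "\<dots> = \<bar>q * y - p\<bar>"
    unfolding abs_mult[symmetric] using assms(3) by (simp add: algebra_simps)
  finally show ?thesis .
qed

lemma avoids_line:
  fixes y :: real and A B C :: int
  assumes "has_level (line_height A B) i" "avoids i y" "B \<noteq> 0"
  shows "rho i * \<bar>real_of_int B\<bar> \<le> \<bar>A * \<theta> - B * y + C\<bar>"
proof -
  have ev: "line_height (- A) (- B) = line_height A B" for A B
    unfolding line_height_def abs_star_def by simp
  have z: "(A * \<theta> + C) / B \<in> line_centres i"
  proof (cases "B > 0")
    case True
    then show ?thesis unfolding line_centres_def using assms by blast
  next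
    case False
    have "(A * \<theta> + C) / B = (real_of_int (- A) * \<theta> + real_of_int (- C)) / real_of_int (- B)"
      using assms(3) by (simp add: field_simps)
    moreover have "0 < - B \<and> has_level (line_height (- A) (- B)) i" using assms False ev[of A B] by auto
    ultimately show ?thesis unfolding line_centres_def by blast
  qed
  then have "rho i \<le> \<bar>y - (A * \<theta> + C) / B\<bar>" using assms(2) unfolding avoids_def by blast
  then have "rho i * \<bar>real_of_int B\<bar> \<le> \<bar>y - (A * \<theta> + C) / B\<bar> * \<bar>real_of_int B\<bar>"
    by (intro mult_right_mono) auto
  also have "\<dots> = \<bar>y * B - (A * \<theta> + C)\<bar>"
    unfolding abs_mult[symmetric] using assms(3) by (simp add: left_diff_distrib)
  also have "\<dots> = \<bar>A * \<theta> - B * y + C\<bar>" by (simp add: algebra_simps abs_minus_commute)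
  finally show ?thesis .
qed

lemma rho_ge:
  assumes "has_level h j" "j \<le> i"
  shows "\<epsilon> / (growth i * h) \<le> rho j"
proof -
  have "growth j * height_bd j \<le> growth i * h"
    using assms growth_mono[of j i] growth_pos[of i] height_bd_pos[of j] unfolding has_level_def
    by (intro mult_mono) auto
  then show ?thesis unfolding rho_def using eps growth_pos[of j] height_bd_pos[of j]
    by (intro divide_left_mono) (auto intro: mult_pos_pos less_le_trans)
qed

text \<open>Multiplying the bound on \<open>h\<close> by \<open>(height_bd i * l)^2\<close>, which
  is at least \<open>1\<close>, shows \<open>h \<le> height_bd i\<close>, so the level is at most
  \<open>i\<close>. The radius is at least \<open>l\<close> because \<open>growth i\<close> is at
  most \<open>\<epsilon> * (height_bd i * l)\<close>. Dual vectors of such height therefore belong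
  to danger sets that have been avoided already.\<close>

lemma early_level:
  assumes "1 \<le> h" "h \<le> 1 / (height_bd i * l\<^sup>2)" "0 < l" "growth i \<le> \<epsilon> * (height_bd i * l)"
    "1 \<le> height_bd i * l"
  obtains j where "has_level h j" "j \<le> i" "l \<le> rho j" "\<epsilon> / (growth i * h) \<le> rho j"
proof -
  obtain j where j: "has_level h j" using height_bd_index[OF assms(1)] unfolding has_level_def by blast
  have T: "0 < height_bd i" by (rule height_bd_pos)
  have hl: "h * (height_bd i * l\<^sup>2) \<le> 1" using assms(2,3) T by (simp add: field_simps)
  have "h * 1 \<le> h * (height_bd i * l)\<^sup>2" using assms by (intro mult_left_mono) auto
  also have "\<dots> = h * (height_bd i * l\<^sup>2) * height_bd i" by (simp add: power2_eq_square)
  also have "\<dots> \<le> 1 * height_bd i" using hl T by (intro mult_right_mono) auto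
  finally have "height_bd j \<le> height_bd i" using j unfolding has_level_def by simp
  then have ji: "j \<le> i" using strict_mono_height_bd by (simp add: strict_mono_less_eq)
  have "l * (growth i * h) \<le> l * (\<epsilon> * (height_bd i * l) * h)"
    using assms by (intro mult_left_mono mult_right_mono) auto
  also have "\<dots> = \<epsilon> * (h * (height_bd i * l\<^sup>2))" by (simp add: power2_eq_square)
  also have "\<dots> \<le> \<epsilon> * 1" using hl eps by (intro mult_left_mono) auto
  finally have "l \<le> \<epsilon> / (growth i * h)"
    using growth_pos[of i] assms(1) by (simp add: pos_le_divide_eq)
  then show thesis using that[OF j ji _ rho_ge[OF j ji]] rho_ge[OF j ji] by linarith
qed

text \<open>The line belongs to an early level, which \<open>y\<close> avoids; the inequality says
  this after multiplication by the height. It will contradict the upper bound for the cross product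
  of two rational points.\<close>

lemma line_form_large:
  fixes y l :: real and A B C :: int
  assumes l: "0 < l" "growth i \<le> \<epsilon> * (height_bd i * l)" "1 \<le> height_bd i * l"
    and av: "\<And>j. j \<le> i \<Longrightarrow> l \<le> rho j \<Longrightarrow> avoids j y"
    and "A \<noteq> 0" "B \<noteq> 0" "\<bar>real_of_int A\<bar> * (real_of_int B)\<^sup>2 \<le> 1 / (height_bd i * l\<^sup>2)"
  shows "\<epsilon> \<le> growth i * (\<bar>real_of_int A\<bar> * \<bar>real_of_int B\<bar> * \<bar>A * \<theta> - B * y + C\<bar>)"
proof -
  have "abs_star A = \<bar>real_of_int A\<bar>" unfolding abs_star_def using assms(5) by linarith
  then have h: "line_height A B = \<bar>real_of_int A\<bar> * (real_of_int B)\<^sup>2" unfolding line_height_def by simp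
  obtain j where j: "has_level (line_height A B) j" "j \<le> i" "l \<le> rho j"
    "\<epsilon> / (growth i * line_height A B) \<le> rho j"
    using early_level[OF line_height_ge_1[OF assms(6)] _ l, of A] assms(7) h by auto
  have "\<epsilon> / (growth i * line_height A B) * \<bar>real_of_int B\<bar> \<le> rho j * \<bar>real_of_int B\<bar>"
    using j by (intro mult_right_mono) auto
  also have "\<dots> \<le> \<bar>A * \<theta> - B * y + C\<bar>"
    by (rule avoids_line[OF j(1) av[OF j(2,3)] assms(6)])
  finally have le: "\<epsilon> / (growth i * line_height A B) * \<bar>real_of_int B\<bar> \<le> \<bar>A * \<theta> - B * y + C\<bar>" .
  have *: "e \<le> g * (a * b * E)" if "e / (g * (a * b\<^sup>2)) * b \<le> E" "0 < g" "0 < a" "0 < b"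
    for e g a b E :: real
    using that by (simp add: field_simps power2_eq_square)
  show ?thesis
    by (rule *) (use le growth_pos[of i] assms(5,6) in \<open>auto simp: h\<close>)
qed

text \<open>As for lines. The integer \<open>r\<close> need not be the nearest one: replacing it by
  the nearest one lowers the height and the product to be bounded below.\<close>

lemma point_form_large:
  fixes y l :: real and q p r :: int
  assumes l: "0 < l" "growth i \<le> \<epsilon> * (height_bd i * l)" "1 \<le> height_bd i * l"
    and av: "\<And>j. j \<le> i \<Longrightarrow> l \<le> rho j \<Longrightarrow> avoids j y"
    and "q \<noteq> 0" "(real_of_int q)\<^sup>2 * \<bar>q * \<theta> - r\<bar> / \<gamma> \<le> 1 / (height_bd i * l\<^sup>2)"
  shows "\<epsilon> * \<gamma> \<le> growth i * (\<bar>real_of_int q\<bar> * \<bar>q * \<theta> - of_int r\<bar> * \<bar>q * y - p\<bar>)"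
proof -
  have d: "int_dist (q * \<theta>) \<le> \<bar>q * \<theta> - of_int r\<bar>" by (rule int_dist_le)
  have "point_height q \<le> (real_of_int q)\<^sup>2 * \<bar>q * \<theta> - of_int r\<bar> / \<gamma>"
    unfolding point_height_def using d gamma by (intro divide_right_mono mult_left_mono) auto
  then have hb: "point_height q \<le> 1 / (height_bd i * l\<^sup>2)" using assms(6) by linarith
  obtain j where j: "has_level (point_height q) j" "j \<le> i" "l \<le> rho j"
    "\<epsilon> / (growth i * point_height q) \<le> rho j"
    using early_level[OF point_height_ge_1[OF assms(5)] hb l] by blast
  have dp: "0 < int_dist (q * \<theta>)"
    using point_height_ge_1[OF assms(5)] gamma int_dist_nonneg[of "q * \<theta>"] unfolding point_height_def
    by (smt (verit, best) divide_eq_0_iff mult_eq_0_iff)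
  have "\<epsilon> / (growth i * point_height q) * \<bar>real_of_int q\<bar> \<le> rho j * \<bar>real_of_int q\<bar>"
    using j by (intro mult_right_mono) auto
  also have "\<dots> \<le> \<bar>q * y - p\<bar>"
    by (rule avoids_point[OF j(1) av[OF j(2,3)] assms(5)])
  finally have le: "\<epsilon> / (growth i * point_height q) * \<bar>real_of_int q\<bar> \<le> \<bar>q * y - p\<bar>" .
  have *: "e * c \<le> g * (Q * d * E)" if "e / (g * (Q\<^sup>2 * d / c)) * Q \<le> E" "0 < g" "0 < Q" "0 < d" "0 < c"
    for e g Q d c E :: real
    using that by (simp add: field_simps power2_eq_square)
  have "\<epsilon> * \<gamma> \<le> growth i * (\<bar>real_of_int q\<bar> * int_dist (q * \<theta>) * \<bar>q * y - p\<bar>)"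
    by (rule *) (use le growth_pos[of i] assms(5) gamma dp in \<open>auto simp: point_height_def\<close>)
  also have "\<dots> \<le> growth i * (\<bar>real_of_int q\<bar> * \<bar>q * \<theta> - of_int r\<bar> * \<bar>q * y - p\<bar>)"
    using d growth_pos[of i] by (intro mult_left_mono mult_right_mono) auto
  finally show ?thesis .
qed

end

section \<open>Counting the centres of one level in one dyadic range\<close>

text \<open>The dyadic range \<open>Q\<close> cancels in \<open>a * b^2\<close>, which becomes the
  height of the dual vector, and in \<open>a * b * e\<close>, which becomes the product bounded
  below in \<open>line_form_large\<close> and \<open>point_form_large\<close>.\<close>

lemma short_cross_product_bounds:
  fixes Q l T \<tau> a b e :: real
  assumes pos: "0 < Q" "0 < l" "0 < T" "0 < \<tau>"
    and a: "0 \<le> a" "a \<le> 8 * \<tau> * Q\<^sup>2 / T" and b: "0 \<le> b" "b \<le> 64 * \<tau> / (Q * l)"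
    and e: "0 \<le> e" "e \<le> 128 * \<tau> / Q"
  shows "a * b\<^sup>2 \<le> 32768 * \<tau> ^ 3 / (T * l\<^sup>2)"
    and "a * b * e \<le> 65536 * \<tau> ^ 3 / (T * l)"
    and "a * e \<le> 1024 * \<tau>\<^sup>2 * Q / T"
    and "b * a * e \<le> 65536 * \<tau> ^ 3 / (T * l)"
proof -
  have "a * b\<^sup>2 \<le> (8 * \<tau> * Q\<^sup>2 / T) * (64 * \<tau> / (Q * l))\<^sup>2"
    using assms by (intro mult_mono power_mono) auto
  also have "\<dots> = 32768 * \<tau> ^ 3 / (T * l\<^sup>2)"
    using pos by (simp add: field_simps power2_eq_square power3_eq_cube)
  finally show "a * b\<^sup>2 \<le> 32768 * \<tau> ^ 3 / (T * l\<^sup>2)" .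
  have "a * b * e \<le> (8 * \<tau> * Q\<^sup>2 / T) * (64 * \<tau> / (Q * l)) * (128 * \<tau> / Q)"
    using assms by (intro mult_mono mult_nonneg_nonneg) auto
  also have "\<dots> = 65536 * \<tau> ^ 3 / (T * l)"
    using pos by (simp add: field_simps power2_eq_square power3_eq_cube)
  finally show *: "a * b * e \<le> 65536 * \<tau> ^ 3 / (T * l)" .
  then show "b * a * e \<le> 65536 * \<tau> ^ 3 / (T * l)" by (simp add: mult.commute)
  have "a * e \<le> (8 * \<tau> * Q\<^sup>2 / T) * (128 * \<tau> / Q)"
    using assms by (intro mult_mono) auto
  also have "\<dots> = 1024 * \<tau>\<^sup>2 * Q / T"
    using pos by (simp add: field_simps power2_eq_square)
  finally show "a * e \<le> 1024 * \<tau>\<^sup>2 * Q / T" .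
qed

context bad_line
begin

text \<open>The first two bounds make the height of a dual point or line small enough for an early
  level, the next two contradict avoidance, and the last two settle the degenerate cross
  products.\<close>

lemma tau_bounds:
  assumes "\<tau> = \<gamma> / 128"
  shows "32768 * \<tau> ^ 3 / \<gamma> \<le> 1" "32768 * \<tau> ^ 3 \<le> 1"
    "65536 * \<tau> ^ 3 < \<gamma>" "65536 * \<tau> ^ 3 < 1" "8192 * \<tau>\<^sup>2 < \<gamma>" "64 * \<tau> < 1"
proof -
  have g2: "\<gamma> * \<gamma> \<le> 1 / 2 * (1 / 2)" using gamma by (intro mult_mono) auto
  have g3: "\<gamma> * \<gamma> * \<gamma> \<le> 1 / 4 * \<gamma>" using g2 gamma by (intro mult_right_mono) auto
  have g2': "\<gamma> * \<gamma> \<le> 1 / 2 * \<gamma>" using gamma by (intro mult_right_mono) auto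
  have e3: "\<tau> ^ 3 = \<gamma> * \<gamma> * \<gamma> / 2097152" and e2: "\<tau>\<^sup>2 = \<gamma> * \<gamma> / 16384"
    and e4: "32768 * (\<gamma> * \<gamma> * \<gamma> / 2097152) / \<gamma> = \<gamma> * \<gamma> / 64"
    unfolding assms using gamma by (simp_all add: power3_eq_cube power2_eq_square)
  show "32768 * \<tau> ^ 3 / \<gamma> \<le> 1" unfolding e3 e4 using g2 by linarith
  show "32768 * \<tau> ^ 3 \<le> 1" "65536 * \<tau> ^ 3 < \<gamma>" "65536 * \<tau> ^ 3 < 1"
    unfolding e3 using g3 gamma by linarith+
  show "8192 * \<tau>\<^sup>2 < \<gamma>" unfolding e2 using g2' gamma by linarith
  show "64 * \<tau> < 1" unfolding assms using gamma by linarith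
qed

text \<open>
  The cross product of two rational points is the rational line through them. If it is short, its
  danger interval belongs to an early level and contains \<open>y\<close>, contrary to assumption; the lines
  \<open>x = const\<close> are excluded by bad approximability of \<open>\<theta>\<close>.
\<close>

lemma point_class_card:
  fixes S :: "real set" and y l :: real
  assumes l: "0 < l" "growth i \<le> \<epsilon> * (height_bd i * l)" "1 \<le> height_bd i * l"
    and av: "\<And>j. j \<le> i \<Longrightarrow> l \<le> rho j \<Longrightarrow> avoids j y"
    and S: "finite S" "\<And>z. z \<in> S \<Longrightarrow> \<bar>z - y\<bar> \<le> l"
    and cl: "\<And>z. z \<in> S \<Longrightarrow> \<exists>p q :: int. z = real_of_int p / q \<and> 0 < q \<and>
      has_level (point_height q) i \<and> 2 ^ k \<le> real_of_int q \<and> real_of_int q < 2 * 2 ^ k"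
  shows "real (card S) \<le> (1024 + 128 / \<gamma>) * (height_bd i * l) + 1"
proof -
  define T where "T = height_bd i"
  define \<tau> where "\<tau> = \<gamma> / 128"
  define Q :: real where "Q = 2 ^ k"
  have pos: "0 < T" "0 < \<tau>" "0 < Q" unfolding T_def \<tau>_def Q_def using height_bd_pos gamma by auto
  note tau = tau_bounds[OF \<tau>_def]
  have "\<forall>z. \<exists>p q :: int. z \<in> S \<longrightarrow> z = real_of_int p / q \<and> 0 < q \<and>
      has_level (point_height q) i \<and> Q \<le> real_of_int q \<and> real_of_int q < 2 * Q"
    using cl unfolding Q_def by blast
  then obtain p q :: "real \<Rightarrow> int" where pq: "\<And>z. z \<in> S \<Longrightarrow> z = real_of_int (p z) / q z \<and> 0 < q z \<and>
      has_level (point_height (q z)) i \<and> Q \<le> real_of_int (q z) \<and> real_of_int (q z) < 2 * Q"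
    by metis
  define r where "r z = round (q z * \<theta>)" for z
  define w where "w z = real_of_int (q z)" for z
  \<comment> \<open>This is \<open>\<theta> - r / q\<close>, the signed horizontal distance of the
    rational point from the line over \<open>\<theta>\<close>.\<close>
  define x where "x z = (w z * \<theta> - r z) / w z" for z
  have w0: "0 < w z" if "z \<in> S" for z using pq[OF that] unfolding w_def by simp
  have zw: "z * w z = p z" if "z \<in> S" for z
  proof -
    have "z = real_of_int (p z) / w z" "w z \<noteq> 0" using pq[OF that] w0[OF that] unfolding w_def by auto
    then show ?thesis by (metis nonzero_mult_div_cancel_right times_divide_eq_left)
  qed
  have xw: "x z * w z = w z * \<theta> - r z" if "z \<in> S" for z
    using w0[OF that] unfolding x_def by simp
  have hb: "point_height (q z) < 8 * T" if "z \<in> S" for z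
    using pq[OF that] height_bd_Suc_le[of i] unfolding has_level_def T_def by linarith
  have "real (card S) \<le> (1024 + 1 / \<tau>) * (T * l) + 1"
  proof (rule card_le_if_no_short_cross_product[OF S(1) pos(3) l(1) pos(1,2), of w x])
    show "Q \<le> w z \<and> w z < 2 * Q" if "z \<in> S" for z using pq[OF that] unfolding w_def by simp
    show "\<bar>x z\<bar> \<le> 8 * T / Q ^ 3" if z: "z \<in> S" for z
    proof -
      have d: "\<bar>w z * \<theta> - r z\<bar> = int_dist (q z * \<theta>)" unfolding int_dist_def w_def r_def by simp
      have "(w z)\<^sup>2 * int_dist (q z * \<theta>) \<le> 8 * T * \<gamma>"
        using hb[OF z] gamma unfolding point_height_def w_def by (simp add: field_simps)
      also have "\<dots> \<le> 8 * T * 1" using gamma pos by (intro mult_left_mono) auto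
      finally have "(w z)\<^sup>2 * \<bar>w z * \<theta> - r z\<bar> \<le> 8 * T" unfolding d by simp
      moreover have "\<bar>x z\<bar> * (w z) ^ 3 = (w z)\<^sup>2 * \<bar>w z * \<theta> - r z\<bar>"
        unfolding x_def using w0[OF z] by (simp add: power2_eq_square power3_eq_cube)
      moreover have "\<bar>x z\<bar> * Q ^ 3 \<le> \<bar>x z\<bar> * (w z) ^ 3"
        using pq[OF z] pos unfolding w_def by (intro mult_left_mono power_mono) auto
      ultimately have "\<bar>x z\<bar> * Q ^ 3 \<le> 8 * T" by linarith
      then show ?thesis using pos by (simp add: pos_le_divide_eq)
    qed
    show "w a * w b * w c * tri_det x a b c \<in> \<int>" if "a \<in> S" "b \<in> S" "c \<in> S" for a b c
    proof -
      \<comment> \<open>Up to sign this is the determinant of the three integer vectors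
        \<open>(q, r, p)\<close>; the terms with \<open>\<theta>\<close> cancel.\<close>
      have "w a * w b * w c * tri_det x a b c =
        (x b * w b) * (c * w c) * w a - (x b * w b) * (a * w a) * w c - (x a * w a) * (c * w c) * w b
        - (x c * w c) * (b * w b) * w a + (x c * w c) * (a * w a) * w b + (x a * w a) * (b * w b) * w c"
        unfolding tri_det_def by (simp add: algebra_simps)
      also have "\<dots> = of_int (- r b * p c * q a + r b * p a * q c + r a * p c * q b
          + r c * p b * q a - r c * p a * q b - r a * p b * q c)"
        unfolding zw[OF that(1)] zw[OF that(2)] zw[OF that(3)] xw[OF that(1)] xw[OF that(2)] xw[OF that(3)]
        unfolding w_def by (simp add: algebra_simps)
      finally show ?thesis by simp
    qed
    fix a b assume ab: "a \<in> S" "b \<in> S" "a < b"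
      and s1: "w a * w b * (b - a) \<le> 8 * \<tau> * Q\<^sup>2 / T"
      and s2: "\<bar>w a * w b * (x b - x a)\<bar> \<le> 64 * \<tau> / (Q * l)"
      and s3: "\<bar>w a * w b * (x a * (b - y) - x b * (a - y))\<bar> \<le> 128 * \<tau> / Q"
    \<comment> \<open>The coordinates of the cross product: \<open>A * x - B * y + C = 0\<close> is
      the line through the points \<open>(r / q, p / q)\<close> of \<open>a\<close> and
      \<open>b\<close>.\<close>
    define A where "A = q a * p b - q b * p a"
    define B where "B = q a * r b - q b * r a"
    define C where "C = r b * p a - r a * p b"
    have "w a * w b * (b - a) = w a * (b * w b) - w b * (a * w a)" by (simp add: algebra_simps)
    also have "\<dots> = A" unfolding zw[OF ab(1)] zw[OF ab(2)] unfolding w_def A_def by simp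
    finally have eA: "w a * w b * (b - a) = A" .
    have "w a * w b * (x b - x a) = w a * (x b * w b) - w b * (x a * w a)" by (simp add: algebra_simps)
    also have "\<dots> = - real_of_int B" unfolding xw[OF ab(1)] xw[OF ab(2)] unfolding w_def B_def by (simp add: algebra_simps)
    finally have eB: "w a * w b * (x b - x a) = - real_of_int B" .
    have "w a * w b * (x a * (b - y) - x b * (a - y))
        = (x a * w a) * (b * w b - w b * y) - (x b * w b) * (a * w a - w a * y)" by (simp add: algebra_simps)
    also have "\<dots> = A * \<theta> - B * y + C"
      unfolding zw[OF ab(1)] zw[OF ab(2)] xw[OF ab(1)] xw[OF ab(2)]
      unfolding w_def A_def B_def C_def by (simp add: algebra_simps)
    finally have eE: "w a * w b * (x a * (b - y) - x b * (a - y)) = A * \<theta> - B * y + C" .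
    have "0 < w a * w b * (b - a)" using w0 ab by simp
    then have A0: "A \<noteq> 0" "\<bar>real_of_int A\<bar> = A" unfolding eA by auto
    note sm = short_cross_product_bounds[OF pos(3) l(1) pos(1,2), of "\<bar>real_of_int A\<bar>" "\<bar>real_of_int B\<bar>"
      "\<bar>A * \<theta> - B * y + C\<bar>", OF abs_ge_zero _ abs_ge_zero _ abs_ge_zero]
    have b1: "\<bar>real_of_int A\<bar> \<le> 8 * \<tau> * Q\<^sup>2 / T" using s1 unfolding eA A0(2) .
    have b2: "\<bar>real_of_int B\<bar> \<le> 64 * \<tau> / (Q * l)" using s2 unfolding eB by simp
    have b3: "\<bar>A * \<theta> - B * y + C\<bar> \<le> 128 * \<tau> / Q" using s3 unfolding eE .
    note sm = sm[OF b1 b2 b3]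
    show False
    proof (cases "B = 0")
      case True
      have "\<gamma> \<le> \<bar>real_of_int A\<bar> * \<bar>A * \<theta> - B * y + C\<bar>" using bad[OF A0(1), of "- C"] True by simp
      also have "\<dots> \<le> 1024 * \<tau>\<^sup>2 * Q / T" by (rule sm(3))
      also have "\<dots> \<le> 1024 * \<tau>\<^sup>2 * (8 * T) / T"
      proof -
        \<comment> \<open>Denominators do not exceed heights, so \<open>Q\<close> is at most of the
          order of \<open>T\<close>.\<close>
        have "real_of_int (q a) \<le> point_height (q a)" using abs_le_point_height[of "q a"] pq[OF ab(1)] by auto
        then have "Q \<le> 8 * T" using pq[OF ab(1)] hb[OF ab(1)] by linarith
        then show ?thesis using pos by (intro divide_right_mono mult_left_mono) auto
      qed
      also have "\<dots> = 8192 * \<tau>\<^sup>2" using pos by simp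
      finally show False using tau by simp
    next
      case False
      have "\<bar>real_of_int A\<bar> * \<bar>real_of_int B\<bar>\<^sup>2 \<le> 32768 * \<tau> ^ 3 / (T * l\<^sup>2)" by (rule sm(1))
      also have "\<dots> \<le> 1 / (T * l\<^sup>2)" using tau pos by (intro divide_right_mono) auto
      finally have h: "\<bar>real_of_int A\<bar> * (real_of_int B)\<^sup>2 \<le> 1 / (height_bd i * l\<^sup>2)" unfolding T_def by simp
      have "\<epsilon> \<le> growth i * (\<bar>real_of_int A\<bar> * \<bar>real_of_int B\<bar> * \<bar>A * \<theta> - B * y + C\<bar>)"
        by (rule line_form_large[OF l _ A0(1) False h]) (rule av)
      also have "\<dots> \<le> \<epsilon> * (T * l) * (65536 * \<tau> ^ 3 / (T * l))"
        using l(2) sm(2) eps pos l(1) unfolding T_def[symmetric] by (intro mult_mono) auto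
      also have "\<dots> = \<epsilon> * (65536 * \<tau> ^ 3)" using pos l by simp
      also have "\<dots> < \<epsilon> * 1" using tau eps by (intro mult_strict_left_mono) auto
      finally show False by simp
    qed
  qed (use S in auto)
  then show ?thesis unfolding T_def \<tau>_def by simp
qed

text \<open>Dually, the cross product of two rational lines is their point of intersection.\<close>

lemma line_class_card:
  fixes S :: "real set" and y l :: real
  assumes l: "0 < l" "growth i \<le> \<epsilon> * (height_bd i * l)" "1 \<le> height_bd i * l"
    and av: "\<And>j. j \<le> i \<Longrightarrow> l \<le> rho j \<Longrightarrow> avoids j y"
    and S: "finite S" "\<And>z. z \<in> S \<Longrightarrow> \<bar>z - y\<bar> \<le> l"
    and cl: "\<And>z. z \<in> S \<Longrightarrow> \<exists>A B C :: int. z = (A * \<theta> + C) / B \<and> 0 < B \<and>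
      has_level (line_height A B) i \<and> 2 ^ k \<le> real_of_int B \<and> real_of_int B < 2 * 2 ^ k"
  shows "real (card S) \<le> (1024 + 128 / \<gamma>) * (height_bd i * l) + 1"
proof -
  define T where "T = height_bd i"
  define \<tau> where "\<tau> = \<gamma> / 128"
  define Q :: real where "Q = 2 ^ k"
  have pos: "0 < T" "0 < \<tau>" "0 < Q" unfolding T_def \<tau>_def Q_def using height_bd_pos gamma by auto
  note tau = tau_bounds[OF \<tau>_def]
  have "\<forall>z. \<exists>A B C :: int. z \<in> S \<longrightarrow> z = (A * \<theta> + C) / B \<and> 0 < B \<and>
      has_level (line_height A B) i \<and> Q \<le> real_of_int B \<and> real_of_int B < 2 * Q"
    using cl unfolding Q_def by blast
  then obtain A B C :: "real \<Rightarrow> int" where pq: "\<And>z. z \<in> S \<Longrightarrow> z = (A z * \<theta> + C z) / B z \<and> 0 < B z \<and>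
      has_level (line_height (A z) (B z)) i \<and> Q \<le> real_of_int (B z) \<and> real_of_int (B z) < 2 * Q"
    by metis
  define w where "w z = real_of_int (B z)" for z
  \<comment> \<open>The slope of the rational line.\<close>
  define x where "x z = A z / w z" for z
  have w0: "0 < w z" if "z \<in> S" for z using pq[OF that] unfolding w_def by simp
  have zw: "z * w z = A z * \<theta> + C z" if "z \<in> S" for z
  proof -
    have "z = (A z * \<theta> + C z) / w z" "w z \<noteq> 0" using pq[OF that] w0[OF that] unfolding w_def by auto
    then show ?thesis by (metis nonzero_mult_div_cancel_right times_divide_eq_left)
  qed
  have xw: "x z * w z = A z" if "z \<in> S" for z
    using w0[OF that] unfolding x_def by simp
  have hb: "line_height (A z) (B z) < 8 * T" if "z \<in> S" for z
    using pq[OF that] height_bd_Suc_le[of i] unfolding has_level_def T_def by linarith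
  have "real (card S) \<le> (1024 + 1 / \<tau>) * (T * l) + 1"
  proof (rule card_le_if_no_short_cross_product[OF S(1) pos(3) l(1) pos(1,2), of w x])
    show "Q \<le> w z \<and> w z < 2 * Q" if "z \<in> S" for z using pq[OF that] unfolding w_def by simp
    show "\<bar>x z\<bar> \<le> 8 * T / Q ^ 3" if z: "z \<in> S" for z
    proof -
      have "\<bar>real_of_int (A z)\<bar> * (w z)\<^sup>2 \<le> line_height (A z) (B z)"
        unfolding line_height_def abs_star_def w_def by (intro mult_right_mono) auto
      then have "(w z)\<^sup>2 * \<bar>real_of_int (A z)\<bar> \<le> 8 * T" using hb[OF z] by (simp add: mult.commute)
      moreover have "\<bar>x z\<bar> * (w z) ^ 3 = (w z)\<^sup>2 * \<bar>real_of_int (A z)\<bar>"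
        unfolding x_def using w0[OF z] by (simp add: power2_eq_square power3_eq_cube)
      moreover have "\<bar>x z\<bar> * Q ^ 3 \<le> \<bar>x z\<bar> * (w z) ^ 3"
        using pq[OF z] pos unfolding w_def by (intro mult_left_mono power_mono) auto
      ultimately have "\<bar>x z\<bar> * Q ^ 3 \<le> 8 * T" by linarith
      then show ?thesis using pos by (simp add: pos_le_divide_eq)
    qed
    show "w a * w b * w c * tri_det x a b c \<in> \<int>" if "a \<in> S" "b \<in> S" "c \<in> S" for a b c
    proof -
      have "w a * w b * w c * tri_det x a b c =
        (x b * w b) * (c * w c) * w a - (x b * w b) * (a * w a) * w c - (x a * w a) * (c * w c) * w b
        - (x c * w c) * (b * w b) * w a + (x c * w c) * (a * w a) * w b + (x a * w a) * (b * w b) * w c"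
        unfolding tri_det_def by (simp add: algebra_simps)
      also have "\<dots> = of_int (A b * C c * B a - A b * C a * B c - A a * C c * B b
          - A c * C b * B a + A c * C a * B b + A a * C b * B c)"
        unfolding zw[OF that(1)] zw[OF that(2)] zw[OF that(3)] xw[OF that(1)] xw[OF that(2)] xw[OF that(3)]
        unfolding w_def by (simp add: algebra_simps)
      finally show ?thesis by simp
    qed
    fix a b assume ab: "a \<in> S" "b \<in> S" "a < b"
      and s1: "w a * w b * (b - a) \<le> 8 * \<tau> * Q\<^sup>2 / T"
      and s2: "\<bar>w a * w b * (x b - x a)\<bar> \<le> 64 * \<tau> / (Q * l)"
      and s3: "\<bar>w a * w b * (x a * (b - y) - x b * (a - y))\<bar> \<le> 128 * \<tau> / Q"
    \<comment> \<open>The cross product is again integral; the two lines meet in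
      \<open>(r / q, p / q)\<close>.\<close>
    define q where "q = B a * A b - B b * A a"
    define r where "r = B b * C a - B a * C b"
    define p where "p = A b * C a - A a * C b"
    have "w a * w b * (b - a) = w a * (b * w b) - w b * (a * w a)" by (simp add: algebra_simps)
    also have "\<dots> = q * \<theta> - r" unfolding zw[OF ab(1)] zw[OF ab(2)] unfolding w_def q_def r_def by (simp add: algebra_simps)
    finally have eA: "w a * w b * (b - a) = q * \<theta> - r" .
    have "w a * w b * (x b - x a) = w a * (x b * w b) - w b * (x a * w a)" by (simp add: algebra_simps)
    also have "\<dots> = q" unfolding xw[OF ab(1)] xw[OF ab(2)] unfolding w_def q_def by (simp add: algebra_simps)
    finally have eB: "w a * w b * (x b - x a) = q" .
    have "w a * w b * (x a * (b - y) - x b * (a - y))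
        = (x a * w a) * (b * w b - w b * y) - (x b * w b) * (a * w a - w a * y)" by (simp add: algebra_simps)
    also have "\<dots> = q * y - p"
      unfolding zw[OF ab(1)] zw[OF ab(2)] xw[OF ab(1)] xw[OF ab(2)] unfolding w_def q_def p_def
      by (simp add: algebra_simps)
    finally have eE: "w a * w b * (x a * (b - y) - x b * (a - y)) = q * y - p" .
    have A0: "0 < q * \<theta> - r" unfolding eA[symmetric] using w0 ab by simp
    have b1: "\<bar>q * \<theta> - r\<bar> \<le> 8 * \<tau> * Q\<^sup>2 / T" using s1 A0 unfolding eA by simp
    have b2: "\<bar>real_of_int q\<bar> \<le> 64 * \<tau> / (Q * l)" using s2 unfolding eB .
    have b3: "\<bar>q * y - p\<bar> \<le> 128 * \<tau> / Q" using s3 unfolding eE .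
    note sm = short_cross_product_bounds[OF pos(3) l(1) pos(1,2), of "\<bar>q * \<theta> - r\<bar>" "\<bar>real_of_int q\<bar>"
      "\<bar>q * y - p\<bar>", OF abs_ge_zero b1 abs_ge_zero b2 abs_ge_zero b3]
    have "q \<noteq> 0"
    proof
      \<comment> \<open>For parallel lines \<open>q * \<theta> - r\<close> is a positive integer,
        yet the bounds make it less than \<open>1\<close>.\<close>
      assume q0: "q = 0"
      have "Q\<^sup>2 \<le> (real_of_int (B a))\<^sup>2" using pq[OF ab(1)] pos by (intro power_mono) auto
      also have "\<dots> \<le> line_height (A a) (B a)" by (rule square_le_line_height)
      finally have "Q\<^sup>2 \<le> 8 * T" using hb[OF ab(1)] by simp
      then have "8 * \<tau> * Q\<^sup>2 / T \<le> 8 * \<tau> * (8 * T) / T"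
        using pos by (intro divide_right_mono mult_left_mono) auto
      also have "\<dots> < 1" using tau pos by simp
      finally have "q * \<theta> - r < 1" using b1 by simp
      then show False using A0 q0 by simp
    qed
    have "(real_of_int q)\<^sup>2 * \<bar>q * \<theta> - r\<bar> / \<gamma> = \<bar>q * \<theta> - r\<bar> * \<bar>real_of_int q\<bar>\<^sup>2 / \<gamma>" by simp
    also have "\<dots> \<le> 32768 * \<tau> ^ 3 / (T * l\<^sup>2) / \<gamma>" using sm(1) gamma by (intro divide_right_mono) auto
    also have "\<dots> = 32768 * \<tau> ^ 3 / \<gamma> / (T * l\<^sup>2)" by simp
    also have "\<dots> \<le> 1 / (T * l\<^sup>2)" using tau(1) pos by (intro divide_right_mono) auto
    finally have h: "(real_of_int q)\<^sup>2 * \<bar>q * \<theta> - r\<bar> / \<gamma> \<le> 1 / (height_bd i * l\<^sup>2)" unfolding T_def .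
    have "\<epsilon> * \<gamma> \<le> growth i * (\<bar>real_of_int q\<bar> * \<bar>q * \<theta> - r\<bar> * \<bar>q * y - p\<bar>)"
      by (rule point_form_large[OF l _ \<open>q \<noteq> 0\<close> h]) (rule av)
    also have "\<dots> \<le> \<epsilon> * (T * l) * (65536 * \<tau> ^ 3 / (T * l))"
      using l(2) sm(4) eps pos l(1) unfolding T_def[symmetric] by (intro mult_mono) auto
    also have "\<dots> = \<epsilon> * (65536 * \<tau> ^ 3)" using pos l by simp
    also have "\<dots> < \<epsilon> * \<gamma>" using tau eps by (intro mult_strict_left_mono) auto
    finally show False by simp
  qed (use S in auto)
  then show ?thesis unfolding T_def \<tau>_def by simp
qed

end

section \<open>Measure of the danger set of one level\<close>

text \<open>Extends the counts, which are proved for finite sets \<open>S\<close>, to a whole class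
  and shows that the class is finite.\<close>

lemma finite_card_le_if_finite_subsets:
  fixes K :: real
  assumes "\<And>G. G \<subseteq> F \<Longrightarrow> finite G \<Longrightarrow> real (card G) \<le> K"
  shows "finite F \<and> real (card F) \<le> K"
proof -
  have "finite F \<and> card F \<le> nat \<lfloor>K\<rfloor>"
    by (rule finite_if_finite_subsets_card_bdd) (use assms in \<open>simp add: le_nat_floor\<close>)
  then show ?thesis using assms by blast
qed

lemma ex_dyadic_bracket:
  fixes q :: int
  assumes "0 < q" "real_of_int q < 2 ^ n"
  obtains k where "k < n" "2 ^ k \<le> real_of_int q" "real_of_int q < 2 * 2 ^ k"
proof -
  obtain k where k: "2 ^ k \<le> nat q" "nat q < 2 ^ (k + 1)"
    using ex_power_ivl1[of 2 "nat q"] assms(1) by (metis int_one_le_iff_zero_less le_refl nat_mono nat_one_as_int)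
  have eq: "real (nat q) = real_of_int q" using assms(1) by simp
  have "real (2 ^ k) \<le> real (nat q)" using k(1) of_nat_le_iff by blast
  then have k1: "2 ^ k \<le> real_of_int q" unfolding eq by simp
  have "real (nat q) < real (2 ^ (k + 1))" using k(2) of_nat_less_iff by blast
  then have k2: "real_of_int q < 2 * 2 ^ k" unfolding eq by simp
  have "(2::real) ^ k < 2 ^ n" using k1 assms(2) by linarith
  then have "k < n" by simp
  then show thesis using that k1 k2 by blast
qed

context bad_line
begin

text \<open>There are \<open>6 * (i + 1)\<close> classes, each with at most
  \<open>(1025 + 128 / \<gamma>) * (height_bd i * l)\<close> centres, and every ball has length
  \<open>4 * rho i\<close>.\<close>

definition removal_const :: real where
  "removal_const = 24 * (1025 + 128 / \<gamma>)"

lemma removal_const_ge_1: "1 \<le> removal_const"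
  unfolding removal_const_def using gamma by (smt (verit) divide_pos_pos)

text \<open>Twice the radius used in \<open>avoids\<close>: if one point of an interval no longer
  than \<open>rho i\<close> is closer than \<open>rho i\<close> to a centre, the whole interval lies
  in \<open>danger i\<close>.\<close>

definition danger :: "nat \<Rightarrow> real set" where
  "danger i = (\<Union>z\<in>point_centres i \<union> line_centres i. ball z (2 * rho i))"

text \<open>Neither \<open>q\<close> nor \<open>B\<close> exceeds the height, which is below
  \<open>2 ^ (3 * i + 3)\<close>. So there are \<open>3 * (i + 1)\<close> dyadic ranges of points
  and as many of lines, and the counts of the classes add up.\<close>

lemma centres_card:
  fixes y l :: real
  assumes l: "0 < l" "growth i \<le> \<epsilon> * (height_bd i * l)" "1 \<le> height_bd i * l"
    and av: "\<And>j. j \<le> i \<Longrightarrow> l \<le> rho j \<Longrightarrow> avoids j y"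
  defines "Z \<equiv> {z \<in> point_centres i \<union> line_centres i. \<bar>z - y\<bar> \<le> l}"
  shows "finite Z" "real (card Z) \<le> removal_const / 4 * ((real i + 1) * (height_bd i * l))"
proof -
  define n where "n = 3 * i + 3"
  define K where "K = (1024 + 128 / \<gamma>) * (height_bd i * l) + 1"
  define P where "P k = {z. \<bar>z - y\<bar> \<le> l \<and> (\<exists>p q :: int. z = real_of_int p / q \<and> 0 < q \<and>
      has_level (point_height q) i \<and> 2 ^ k \<le> real_of_int q \<and> real_of_int q < 2 * 2 ^ k)}" for k :: nat
  define L where "L k = {z. \<bar>z - y\<bar> \<le> l \<and> (\<exists>A B C :: int. z = (A * \<theta> + C) / B \<and> 0 < B \<and>
      has_level (line_height A B) i \<and> 2 ^ k \<le> real_of_int B \<and> real_of_int B < 2 * 2 ^ k)}" for k :: nat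
  have P: "finite (P k) \<and> real (card (P k)) \<le> K" for k
  proof (rule finite_card_le_if_finite_subsets)
    fix G assume G: "G \<subseteq> P k" "finite G"
    show "real (card G) \<le> K"
      unfolding K_def
    proof (rule point_class_card[OF l, of y G k])
      show "\<And>j. j \<le> i \<Longrightarrow> l \<le> rho j \<Longrightarrow> avoids j y" by (rule av)
    qed (use G in \<open>unfold P_def, blast+\<close>)
  qed
  have L: "finite (L k) \<and> real (card (L k)) \<le> K" for k
  proof (rule finite_card_le_if_finite_subsets)
    fix G assume G: "G \<subseteq> L k" "finite G"
    show "real (card G) \<le> K"
      unfolding K_def
    proof (rule line_class_card[OF l, of y G k])
      show "\<And>j. j \<le> i \<Longrightarrow> l \<le> rho j \<Longrightarrow> avoids j y" by (rule av)
    qed (use G in \<open>unfold L_def, blast+\<close>)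
  qed
  have "height_bd (Suc i) \<le> 8 * 2 ^ (3 * i)" using height_bd_Suc_le[of i] height_bd_le_power[of i] by linarith
  then have hn: "height_bd (Suc i) \<le> 2 ^ n" unfolding n_def by (simp add: power_add)
  have sub: "Z \<subseteq> (\<Union>k<n. P k) \<union> (\<Union>k<n. L k)"
  proof
    fix z assume z: "z \<in> Z"
    then have zl: "\<bar>z - y\<bar> \<le> l" and "z \<in> point_centres i \<or> z \<in> line_centres i" unfolding Z_def by auto
    then show "z \<in> (\<Union>k<n. P k) \<union> (\<Union>k<n. L k)"
    proof (elim disjE)
      assume "z \<in> point_centres i"
      then obtain p q :: int where pq: "z = real_of_int p / q" "0 < q" "has_level (point_height q) i"
        unfolding point_centres_def by blast
      have "real_of_int q < 2 ^ n"
        using abs_le_point_height[of q] pq hn unfolding has_level_def by linarith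
      then obtain k where "k < n" "2 ^ k \<le> real_of_int q" "real_of_int q < 2 * 2 ^ k"
        using ex_dyadic_bracket[OF pq(2)] by blast
      then show ?thesis using zl pq unfolding P_def by blast
    next
      assume "z \<in> line_centres i"
      then obtain A B C :: int where ABC: "z = (A * \<theta> + C) / B" "0 < B" "has_level (line_height A B) i"
        unfolding line_centres_def by blast
      have "real_of_int B \<le> (real_of_int B)\<^sup>2"
        using ABC(2) self_le_power[of "real_of_int B" 2] by simp
      then have "real_of_int B < 2 ^ n"
        using square_le_line_height[of B A] ABC hn unfolding has_level_def by linarith
      then obtain k where "k < n" "2 ^ k \<le> real_of_int B" "real_of_int B < 2 * 2 ^ k"
        using ex_dyadic_bracket[OF ABC(2)] by blast
      then show ?thesis using zl ABC unfolding L_def by blast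
    qed
  qed
  have fin: "finite ((\<Union>k<n. P k) \<union> (\<Union>k<n. L k))" using P L by auto
  then show "finite Z" using sub finite_subset by blast
  have "real (card Z) \<le> real (card ((\<Union>k<n. P k) \<union> (\<Union>k<n. L k)))"
    using card_mono[OF fin sub] by simp
  also have "\<dots> \<le> real (card (\<Union>k<n. P k) + card (\<Union>k<n. L k))"
    using card_Un_le[of "\<Union>k<n. P k" "\<Union>k<n. L k"] of_nat_le_iff by blast
  also have "\<dots> \<le> real ((\<Sum>k<n. card (P k)) + (\<Sum>k<n. card (L k)))"
    by (intro of_nat_mono add_mono card_UN_le) auto
  also have "\<dots> = (\<Sum>k<n. real (card (P k))) + (\<Sum>k<n. real (card (L k)))" by simp
  also have "\<dots> \<le> (\<Sum>k<n. K) + (\<Sum>k<n. K)" using P L by (intro add_mono sum_mono) auto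
  also have "\<dots> = 6 * (real i + 1) * K" unfolding n_def by (simp add: algebra_simps)
  also have "\<dots> \<le> 6 * (real i + 1) * ((1025 + 128 / \<gamma>) * (height_bd i * l))"
    unfolding K_def using l(3) by (intro mult_left_mono) (auto simp: algebra_simps)
  also have "\<dots> = removal_const / 4 * ((real i + 1) * (height_bd i * l))"
    unfolding removal_const_def by (simp only: mult_ac times_divide_eq_right) simp
  finally show "real (card Z) \<le> removal_const / 4 * ((real i + 1) * (height_bd i * l))" .
qed

text \<open>Number of centres times length of the balls. The factor \<open>i + 1\<close> of
  \<open>growth i\<close> cancels the number of dyadic ranges and leaves the proportion
  \<open>1 / lam i\<close>.\<close>

lemma danger_measure:
  fixes a l :: real
  assumes l: "0 < l" "growth i \<le> \<epsilon> * (height_bd i * l)" "1 \<le> height_bd i * l"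
    and av: "\<And>j. j \<le> i \<Longrightarrow> l \<le> rho j \<Longrightarrow> avoids j (a + l / 2)"
  shows "emeasure lborel (danger i \<inter> {a..<a + l}) \<le> ennreal (removal_const * \<epsilon> * l / lam i)"
proof -
  define y where "y = a + l / 2"
  define Z where "Z = {z \<in> point_centres i \<union> line_centres i. \<bar>z - y\<bar> \<le> l}"
  note card = centres_card[OF l av, folded y_def, folded Z_def]
  have g1: "1 \<le> growth i"
    using growth_mono[of 0 i] by (simp add: growth_def lam_def)
  have "rho i \<le> \<epsilon> / height_bd i"
    unfolding rho_def using g1 height_bd_pos[of i] eps
    by (intro divide_left_mono) (auto simp: mult_le_cancel_right1)
  also have "\<dots> \<le> l / 4"
    using l(3) eps height_bd_pos[of i] by (simp add: field_simps)
  \<comment> \<open>A ball of radius \<open>2 * rho i\<close> that meets the interval therefore has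
    its centre within \<open>l\<close> of the midpoint \<open>y\<close>.\<close>
  finally have r: "rho i \<le> l / 4" .
  have sub: "danger i \<inter> {a..<a + l} \<subseteq> (\<Union>z\<in>Z. ball z (2 * rho i))"
  proof
    fix x assume x: "x \<in> danger i \<inter> {a..<a + l}"
    then obtain z where z: "z \<in> point_centres i \<union> line_centres i" "\<bar>z - x\<bar> < 2 * rho i"
      unfolding danger_def by (auto simp: dist_real_def)
    have "\<bar>x - y\<bar> \<le> l / 2" using x unfolding y_def by (auto simp: abs_le_iff field_simps)
    then have "\<bar>z - y\<bar> \<le> l" using z(2) r by linarith
    then show "x \<in> (\<Union>z\<in>Z. ball z (2 * rho i))" using z unfolding Z_def by (auto simp: dist_real_def)
  qed
  have "emeasure lborel (danger i \<inter> {a..<a + l}) \<le> emeasure lborel (\<Union>z\<in>Z. ball z (2 * rho i))"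
    by (rule emeasure_mono[OF sub]) (auto intro!: borel_open)
  also have "\<dots> \<le> (\<Sum>z\<in>Z. emeasure lborel (ball z (2 * rho i)))"
    by (rule emeasure_subadditive_finite) (use card in auto)
  also have "\<dots> = (\<Sum>z\<in>Z. ennreal (4 * rho i))"
    using rho_pos[of i] by (simp add: ball_eq_greaterThanLessThan)
  also have "\<dots> = ennreal (real (card Z) * (4 * rho i))"
    using rho_pos[of i] by (simp add: ennreal_of_nat_eq_real_of_nat ennreal_mult)
  also have "\<dots> \<le> ennreal (removal_const / 4 * ((real i + 1) * (height_bd i * l)) * (4 * rho i))"
    using card rho_pos[of i] by (intro ennreal_leI mult_right_mono) auto
  also have "removal_const / 4 * ((real i + 1) * (height_bd i * l)) * (4 * rho i) = removal_const * \<epsilon> * l / lam i"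
  proof -
    have "c / 4 * (n * (T * l)) * (4 * (e / (n * m * T))) = c * e * l / m"
      if "0 < n" "0 < T" "0 < m" for c n T e m :: real
      using that by (simp add: field_simps)
    from this[of "real i + 1" "height_bd i" "lam i" removal_const \<epsilon>] show ?thesis
      unfolding rho_def growth_def using height_bd_pos[of i] lam_ge_1[of i] by simp
  qed
  finally show ?thesis .
qed

lemma danger_borel [measurable]: "danger i \<in> sets borel"
  unfolding danger_def by (intro borel_open open_UN) auto

end

section \<open>Repeated halving and the potential\<close>

text \<open>One of the two halves carries at most half of the integral. Integrals run over half-open
  intervals, so that the halves are disjoint; the closed ones are nested for the sake of
  compactness.\<close>

lemma halving_sequence:
  fixes G :: "nat \<Rightarrow> real \<Rightarrow> ennreal"
  assumes [measurable]: "\<And>n. G n \<in> borel_measurable borel" and "0 < L"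
  obtains a where
    "\<And>n. {a (Suc n)..a (Suc n) + L / 2 ^ Suc n} \<subseteq> {a n..a n + L / 2 ^ n}"
    "\<And>n. 2 * (\<integral>\<^sup>+x\<in>{a (Suc n)..<a (Suc n) + L / 2 ^ Suc n}. G n x \<partial>lborel)
      \<le> (\<integral>\<^sup>+x\<in>{a n..<a n + L / 2 ^ n}. G n x \<partial>lborel)"
proof -
  let ?R = "\<lambda>n a b. {b..b + L / 2 ^ Suc n} \<subseteq> {a..a + L / 2 ^ n} \<and>
    2 * (\<integral>\<^sup>+x\<in>{b..<b + L / 2 ^ Suc n}. G n x \<partial>lborel) \<le> (\<integral>\<^sup>+x\<in>{a..<a + L / 2 ^ n}. G n x \<partial>lborel)"
  have ex: "\<exists>b. ?R n a b" for n a
  proof -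
    define h where "h = L / 2 ^ Suc n"
    have h0: "0 < h" and hh: "L / 2 ^ n = h + h" unfolding h_def using assms(2) by auto
    let ?I = "\<lambda>b. \<integral>\<^sup>+x\<in>{b..<b + h}. G n x \<partial>lborel"
    have "{a..<a + (h + h)} = {a..<a + h} \<union> {a + h..<a + h + h}" using h0 by auto
    then have "(\<integral>\<^sup>+x\<in>{a..<a + (h + h)}. G n x \<partial>lborel) = ?I a + ?I (a + h)"
      using nn_integral_disjoint_pair[of "G n" lborel "{a..<a + h}" "{a + h..<a + h + h}"] by simp
    moreover have "2 * ?I a \<le> ?I a + ?I (a + h) \<or> 2 * ?I (a + h) \<le> ?I a + ?I (a + h)"
    proof (cases "?I a \<le> ?I (a + h)")
      case True
      then show ?thesis unfolding mult_2 by (intro disjI1 add_left_mono)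
    next
      case False
      then show ?thesis unfolding mult_2 by (intro disjI2 add_right_mono) simp
    qed
    ultimately have "2 * ?I a \<le> (\<integral>\<^sup>+x\<in>{a..<a + (h + h)}. G n x \<partial>lborel) \<or>
        2 * ?I (a + h) \<le> (\<integral>\<^sup>+x\<in>{a..<a + (h + h)}. G n x \<partial>lborel)" by simp
    moreover have "{a..a + h} \<subseteq> {a..a + (h + h)}" "{a + h..a + h + h} \<subseteq> {a..a + (h + h)}" using h0 by auto
    ultimately show ?thesis unfolding hh h_def[symmetric] by blast
  qed
  have "\<exists>a. \<forall>n. True \<and> ?R n (a n) (a (Suc n))"
  proof (rule dependent_nat_choice[of "\<lambda>_ _. True" ?R])
    show "\<exists>y. True \<and> ?R n x y" for x n using ex[of n x] by blast
  qed blast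
  then obtain a where "\<And>n. ?R n (a n) (a (Suc n))" by blast
  then show thesis using that[of a] by simp
qed

lemma ennreal_le_half:
  assumes "2 * x \<le> ennreal c" "0 \<le> c"
  shows "x \<le> ennreal (c / 2)"
proof (cases x)
  case (real r)
  have "ennreal (2 * r) \<le> ennreal c" using assms(1) real by (simp add: ennreal_mult)
  then show ?thesis using real assms(2) by (simp add: ennreal_leI)
next
  case top
  then show ?thesis using assms by (simp add: ennreal_mult_top top_unique)
qed

text \<open>
  The sets to be avoided are the danger sets and balls around the cover elements \<open>[v k - d k, v k + d k]\<close>.
  At step \<open>n\<close> the potential is the sum of their indicator functions with weights that decrease
  slowly enough for a set still to have weight at least \<open>1/2\<close> when the current interval has become
  shorter than it, and fast enough to make room for the danger set that enters at the next step.
\<close>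

locale removal = bad_line +
  fixes M :: nat and s :: real and d v :: "nat \<Rightarrow> real"
  assumes s: "0 < s" "s < 1"
    and M: "8 \<le> M" "1 / \<epsilon> = 32 * removal_const * (real M + 1)" "(1 / \<epsilon>)\<^sup>2 \<le> 2 ^ M"
      "2 powr (s - 1) \<le> 1 - 1 / (2 * (real M + 1))"
    and d: "\<And>k. 0 < d k" "\<And>k. d k \<le> 1" "(\<Sum>k. ennreal (d k powr s)) \<le> ennreal (1 / 48)"
begin

text \<open>The initial length \<open>1 / \<epsilon>\<close> makes
  \<open>height_bd i * ell i\<close> equal to \<open>(i + 1)^2 / \<epsilon>\<close>, so that the
  delay dominates \<open>growth i\<close> as the counting requires.\<close>

definition ell :: "nat \<Rightarrow> real" where
  "ell n = 1 / \<epsilon> / 2 ^ n"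

text \<open>Relative loss of weight at step \<open>m\<close>. A danger set of level \<open>i\<close>
  is carried for at most \<open>M * lam i\<close> steps that cost at most \<open>eta i\<close> each,
  which amounts to at most \<open>1 / 2\<close>.\<close>

definition eta :: "nat \<Rightarrow> real" where
  "eta m = 1 / (2 * (real M + 1) * lam m)"

definition omega :: "nat \<Rightarrow> nat \<Rightarrow> real" where
  "omega i n = (\<Prod>m = i..<n. 1 - eta m)"

text \<open>The weight of a cover ball is chosen such that its initial integral is a constant times
  \<open>d k powr s\<close>, that halving multiplies it by \<open>2 powr (s - 1)\<close>, and that
  it is of order \<open>1\<close> once the interval has length about \<open>d k\<close>. The radius
  \<open>3 * d k\<close> lets the ball contain any interval of length at most \<open>d k\<close>
  that has a point within \<open>d k\<close> of \<open>v k\<close>.\<close>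

definition pot :: "nat \<Rightarrow> real \<Rightarrow> ennreal" where
  "pot n x = (\<Sum>i\<le>n. ennreal (omega i n) * indicator (danger i) x)
    + (\<Sum>k. ennreal ((ell n / d k) powr (1 - s)) * indicator (ball (v k) (3 * d k)) x)"

lemma pot_measurable [measurable]: "pot n \<in> borel_measurable borel"
proof -
  have [measurable]: "ball (v k) (3 * d k) \<in> sets borel" for k by auto
  show ?thesis unfolding pot_def[abs_def] by measurable
qed

lemma ell_pos: "0 < ell n"
  unfolding ell_def using eps by simp

lemma ell_Suc: "ell (Suc n) = ell n / 2"
  unfolding ell_def by simp

lemma ell_antimono: "m \<le> n \<Longrightarrow> ell n \<le> ell m"
  unfolding ell_def using eps by (intro divide_left_mono) (auto intro: power_increasing)

lemma ex_ell_le: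
  assumes "0 < r"
  shows "\<exists>n. ell n \<le> r"
proof -
  obtain n where "1 / \<epsilon> / r < 2 ^ n" using real_arch_pow[of 2 "1 / \<epsilon> / r"] by auto
  then have "ell n \<le> r" unfolding ell_def using assms eps by (simp add: field_simps)
  then show ?thesis by blast
qed

lemma eps_less_inverse: "\<epsilon> < 1 / \<epsilon>"
proof -
  have "\<epsilon> * \<epsilon> < 1 * 1" using eps by (intro mult_strict_mono) auto
  then show ?thesis using eps by (simp add: field_simps)
qed

lemma eta_bounds: "0 < eta m" "eta m \<le> 1 / (2 * (real M + 1))" "eta m \<le> 1"
proof -
  have l: "1 \<le> lam m" by (rule lam_ge_1)
  show "0 < eta m" unfolding eta_def using l by simp
  have "2 * (real M + 1) * 1 \<le> 2 * (real M + 1) * lam m" using l by (intro mult_left_mono) auto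
  then show e: "eta m \<le> 1 / (2 * (real M + 1))" unfolding eta_def using l by (intro divide_left_mono) auto
  also have "\<dots> \<le> 1" by simp
  finally show "eta m \<le> 1" .
qed

lemma eta_antimono: "i \<le> m \<Longrightarrow> eta m \<le> eta i"
  unfolding eta_def using lam_mono[of i m] lam_ge_1[of i] by (intro divide_left_mono mult_left_mono) auto

lemma omega_nonneg: "0 \<le> omega i n"
  unfolding omega_def using eta_bounds by (intro prod_nonneg) auto

lemma omega_Suc: "i \<le> n \<Longrightarrow> omega i (Suc n) = omega i n * (1 - eta n)"
  unfolding omega_def by (simp add: mult.commute)

lemma rho_le: "rho i \<le> \<epsilon> / 2 ^ i"
proof -
  have "1 \<le> growth i" using growth_mono[of 0 i] by (simp add: growth_def lam_def)
  then have "1 * 2 ^ i \<le> growth i * height_bd i"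
    using power2_le_height_bd[of i] by (intro mult_mono) auto
  then show ?thesis unfolding rho_def using eps growth_pos height_bd_pos by (intro divide_left_mono) auto
qed

lemma rho_less_ell: "rho i < ell i"
proof -
  have "\<epsilon> / 2 ^ i < 1 / \<epsilon> / 2 ^ i" using eps_less_inverse by (intro divide_strict_right_mono) auto
  then show ?thesis using rho_le[of i] unfolding ell_def by linarith
qed

lemma rho_ge_power: "\<epsilon> / (2 ^ i * (real i + 1) ^ 4) \<le> rho i"
proof -
  have "growth i * height_bd i \<le> (real i + 1)\<^sup>2 * height_bd i"
    using growth_le_square height_bd_pos[of i] by (intro mult_right_mono) auto
  also have "\<dots> = 2 ^ i * (real i + 1) ^ 4" unfolding height_bd_def by (simp add: power4_eq_xxxx power2_eq_square)
  finally show ?thesis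
    unfolding rho_def using eps growth_pos height_bd_pos by (intro divide_left_mono) auto
qed

text \<open>While \<open>ell n\<close> exceeds \<open>rho i\<close>, \<open>2 ^ (n - i)\<close> is
  less than \<open>(1 / \<epsilon>)^2 * (i + 1) ^ 4\<close>. The size of \<open>M\<close> turns this
  into at most \<open>M * lam i\<close> steps, whose losses sum to at most
  \<open>1 / 2\<close>.\<close>

lemma omega_ge_half:
  assumes "i \<le> n" "rho i < ell n"
  shows "1 / 2 \<le> omega i n"
proof -
  have le: "real (n - i) \<le> M * lam i"
  proof (rule ccontr)
    assume "\<not> ?thesis"
    then have big: "M * lam i < real (n - i)" by simp
    define y where "y = real i + 1"
    have y: "1 \<le> y" unfolding y_def by simp
    have ln2: "1 / 2 \<le> ln (2::real)" using ln_le_minus_one[of "1 / 2 :: real"] by (simp add: ln_div)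
    \<comment> \<open>\<open>8 \<le> M\<close> yields \<open>4 \<le> M * ln 2\<close>, hence
      \<open>y ^ 4 \<le> 2 powr (M * ln y)\<close>.\<close>
    have "4 \<le> real M * (1 / 2)" using M(1) by simp
    also have "\<dots> \<le> real M * ln 2" using ln2 by (intro mult_left_mono) auto
    finally have "4 * ln y \<le> real M * ln 2 * ln y" using y by (intro mult_right_mono) auto
    then have "y ^ 4 \<le> 2 powr (M * ln y)"
      using y by (simp add: powr_def powr_realpow[symmetric] mult_ac)
    moreover have "(1 / \<epsilon>)\<^sup>2 \<le> 2 powr M" using M(3) by (simp add: powr_realpow)
    ultimately have "(1 / \<epsilon>)\<^sup>2 * y ^ 4 \<le> 2 powr M * 2 powr (M * ln y)" using y by (intro mult_mono) auto
    also have "\<dots> = 2 powr (M * lam i)" unfolding lam_def y_def by (simp add: powr_add distrib_left)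
    also have "\<dots> \<le> 2 powr real (n - i)" using big by (intro powr_mono) auto
    also have "\<dots> = 2 ^ (n - i)" by (simp add: powr_realpow)
    finally have "(1 / \<epsilon>)\<^sup>2 * y ^ 4 * 2 ^ i \<le> 2 ^ (n - i) * 2 ^ i" by (intro mult_right_mono) auto
    also have "\<dots> = 2 ^ n" using assms(1) by (simp add: power_add[symmetric])
    finally have "ell n \<le> 1 / \<epsilon> / ((1 / \<epsilon>)\<^sup>2 * y ^ 4 * 2 ^ i)"
      unfolding ell_def using eps y by (intro divide_left_mono) auto
    also have "\<dots> = \<epsilon> / (2 ^ i * y ^ 4)" using eps y by (simp add: field_simps power2_eq_square)
    also have "\<dots> \<le> rho i" unfolding y_def by (rule rho_ge_power)
    finally show False using assms(2) by simp
  qed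
  have "(\<Sum>m = i..<n. eta m) \<le> (\<Sum>m = i..<n. eta i)" by (intro sum_mono eta_antimono) auto
  also have "\<dots> = real (n - i) * eta i" by simp
  also have "\<dots> \<le> M * lam i * eta i" using le eta_bounds[of i] by (intro mult_right_mono) auto
  also have "\<dots> = M / (2 * (real M + 1))" unfolding eta_def using lam_ge_1[of i] by simp
  also have "\<dots> \<le> 1 / 2" by (simp add: field_simps)
  finally have "1 / 2 \<le> 1 - (\<Sum>m = i..<n. eta m)" by simp
  also have "\<dots> \<le> omega i n"
    unfolding omega_def by (rule Weierstrass_prod_ineq) (use eta_bounds in \<open>auto simp: less_imp_le\<close>)
  finally show ?thesis .
qed

text \<open>All old weights shrink at least by the factor \<open>1 - eta n\<close>, those of the
  cover balls because of the assumption on \<open>2 powr (s - 1)\<close>; the new danger set enters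
  with weight \<open>1\<close>.\<close>

lemma pot_Suc: "pot (Suc n) x \<le> ennreal (1 - eta n) * pot n x + indicator (danger (Suc n)) x"
proof -
  have e: "0 \<le> 1 - eta n" using eta_bounds[of n] by simp
  have "(\<Sum>i\<le>Suc n. ennreal (omega i (Suc n)) * indicator (danger i) x)
      = (\<Sum>i\<le>n. ennreal (omega i (Suc n)) * indicator (danger i) x) + indicator (danger (Suc n)) x"
    by (simp add: omega_def)
  also have "(\<Sum>i\<le>n. ennreal (omega i (Suc n)) * indicator (danger i) x)
      = ennreal (1 - eta n) * (\<Sum>i\<le>n. ennreal (omega i n) * indicator (danger i) x)"
    unfolding sum_distrib_left
    by (intro sum.cong refl) (use e omega_nonneg in \<open>auto simp: omega_Suc ennreal_mult mult_ac\<close>)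
  finally have 1: "(\<Sum>i\<le>Suc n. ennreal (omega i (Suc n)) * indicator (danger i) x)
      = ennreal (1 - eta n) * (\<Sum>i\<le>n. ennreal (omega i n) * indicator (danger i) x) + indicator (danger (Suc n)) x" .
  have w: "ennreal ((ell (Suc n) / d k) powr (1 - s)) \<le> ennreal (1 - eta n) * ennreal ((ell n / d k) powr (1 - s))" for k
  proof -
    have "(ell (Suc n) / d k) powr (1 - s) = (1 / 2 * (ell n / d k)) powr (1 - s)" unfolding ell_Suc by simp
    also have "\<dots> = (1 / 2) powr (1 - s) * (ell n / d k) powr (1 - s)" by (rule powr_mult)
    also have "(1 / 2 :: real) powr (1 - s) = 2 powr (s - 1)"
      using powr_minus[of "2::real" "1 - s"] by (simp add: powr_divide inverse_eq_divide)
    finally have eq: "(ell (Suc n) / d k) powr (1 - s) = 2 powr (s - 1) * (ell n / d k) powr (1 - s)" .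
    have "2 powr (s - 1) \<le> 1 - eta n" using M(4) eta_bounds(2)[of n] by linarith
    then show ?thesis unfolding eq ennreal_mult[OF e powr_ge_zero, symmetric]
      by (intro ennreal_leI mult_right_mono) auto
  qed
  have "(\<Sum>k. ennreal ((ell (Suc n) / d k) powr (1 - s)) * indicator (ball (v k) (3 * d k)) x)
      \<le> (\<Sum>k. ennreal (1 - eta n) * (ennreal ((ell n / d k) powr (1 - s)) * indicator (ball (v k) (3 * d k)) x))"
    by (intro suminf_le summableI) (use w in \<open>auto simp: mult.assoc[symmetric] intro!: mult_right_mono\<close>)
  also have "\<dots> = ennreal (1 - eta n) * (\<Sum>k. ennreal ((ell n / d k) powr (1 - s)) * indicator (ball (v k) (3 * d k)) x)"
    by (rule ennreal_suminf_cmult)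
  finally show ?thesis unfolding pot_def 1 distrib_left by (simp add: add_ac add_left_mono)
qed

lemma pot_ge_danger: "i \<le> n \<Longrightarrow> ennreal (omega i n) * indicator (danger i) x \<le> pot n x"
  unfolding pot_def by (intro add_increasing2 member_le_sum) auto

lemma pot_ge_ball:
  "ennreal ((ell n / d k) powr (1 - s)) * indicator (ball (v k) (3 * d k)) x \<le> pot n x"
proof -
  define f where "f k = ennreal ((ell n / d k) powr (1 - s)) * indicator (ball (v k) (3 * d k)) x" for k
  have "sum f {k} \<le> suminf f" by (rule sum_le_suminf) (auto intro: summableI)
  also have "\<dots> \<le> pot n x" unfolding pot_def f_def[abs_def] by simp
  finally have "f k \<le> pot n x" by simp
  then show ?thesis unfolding f_def .
qed

lemma pot_integral_ge:
  assumes "\<And>x. x \<in> {a..<a + l} \<Longrightarrow> ennreal c \<le> pot n x" "0 \<le> l" "0 \<le> c"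
  shows "ennreal (c * l) \<le> (\<integral>\<^sup>+x\<in>{a..<a + l}. pot n x \<partial>lborel)"
proof -
  have "ennreal (c * l) = (\<integral>\<^sup>+x\<in>{a..<a + l}. ennreal c \<partial>lborel)"
    using assms by (simp add: nn_integral_cmult_indicator ennreal_mult)
  also have "\<dots> \<le> (\<integral>\<^sup>+x\<in>{a..<a + l}. pot n x \<partial>lborel)"
    using assms by (intro nn_integral_mono) (auto split: split_indicator)
  finally show ?thesis .
qed

lemma level_conditions:
  "growth i \<le> \<epsilon> * (height_bd i * ell i)" "1 \<le> height_bd i * ell i"
proof -
  have eq: "height_bd i * ell i = (real i + 1)\<^sup>2 / \<epsilon>" unfolding height_bd_def ell_def by simp
  show "growth i \<le> \<epsilon> * (height_bd i * ell i)" unfolding eq using growth_le_square[of i] eps by simp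
  have "\<epsilon> \<le> 1" using eps by simp
  also have "1 \<le> (real i + 1)\<^sup>2" by simp
  finally show "1 \<le> height_bd i * ell i" unfolding eq using eps by (simp add: field_simps)
qed

lemma removal_eps: "removal_const * \<epsilon> = 1 / (32 * (real M + 1))"
proof -
  have "1 = 32 * removal_const * (real M + 1) * \<epsilon>" using M(2) eps by (simp add: field_simps)
  then show ?thesis by (simp add: field_simps)
qed

text \<open>The danger set of level 0 and the cover balls contribute at most
  \<open>ell 0 / 8\<close> each. A ball contributes at most \<open>6 * ell 0 * d k powr s\<close>,
  since \<open>ell 0 \<ge> 1\<close>, and the sum over \<open>k\<close> is bounded by
  \<open>1 / 48\<close>.\<close>

lemma pot_initial: "(\<integral>\<^sup>+x\<in>{a..<a + ell 0}. pot 0 x \<partial>lborel) \<le> ennreal (ell 0 / 4)"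
proof -
  let ?J = "{a..<a + ell 0}"
  let ?B = "\<lambda>k x. ennreal ((ell 0 / d k) powr (1 - s)) * indicator (ball (v k) (3 * d k)) x"
  have [measurable]: "ball (v k) (3 * d k) \<in> sets borel" for k by auto
  have "(\<integral>\<^sup>+x\<in>?J. pot 0 x \<partial>lborel) \<le> (\<integral>\<^sup>+x. indicator (danger 0 \<inter> ?J) x + (\<Sum>k. ?B k x) \<partial>lborel)"
    by (intro nn_integral_mono) (auto simp: pot_def omega_def split: split_indicator)
  also have "\<dots> = emeasure lborel (danger 0 \<inter> ?J) + (\<Sum>k. \<integral>\<^sup>+x. ?B k x \<partial>lborel)"
    by (subst nn_integral_add) (auto simp: nn_integral_suminf)
  also have "\<dots> \<le> ennreal (ell 0 / 8) + ennreal (ell 0 / 8)"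
  proof (intro add_mono)
    have "emeasure lborel (danger 0 \<inter> ?J) \<le> ennreal (removal_const * \<epsilon> * ell 0 / lam 0)"
      by (rule danger_measure[OF ell_pos level_conditions]) (use rho_less_ell[of 0] in auto)
    also have "\<dots> \<le> ennreal (ell 0 / 8)"
    proof (intro ennreal_leI)
      have "1 / (32 * (real M + 1)) \<le> 1 / 8" by (simp add: field_simps)
      then have "1 / (32 * (real M + 1)) * ell 0 \<le> 1 / 8 * ell 0"
        using ell_pos[of 0] by (intro mult_right_mono) auto
      then show "removal_const * \<epsilon> * ell 0 / lam 0 \<le> ell 0 / 8" unfolding removal_eps by (simp add: lam_def)
    qed
    finally show "emeasure lborel (danger 0 \<inter> ?J) \<le> ennreal (ell 0 / 8)" .
    have l1: "1 \<le> ell 0" unfolding ell_def using eps by (simp add: field_simps)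
    have "(\<integral>\<^sup>+x. ?B k x \<partial>lborel) \<le> ennreal (6 * ell 0) * ennreal (d k powr s)" for k
    proof -
      have "(\<integral>\<^sup>+x. ?B k x \<partial>lborel) = ennreal ((ell 0 / d k) powr (1 - s)) * emeasure lborel (ball (v k) (3 * d k))"
        by (rule nn_integral_cmult_indicator) auto
      also have "emeasure lborel (ball (v k) (3 * d k)) = ennreal (6 * d k)"
        using d(1)[of k] by (simp add: ball_eq_greaterThanLessThan)
      also have "ennreal ((ell 0 / d k) powr (1 - s)) * ennreal (6 * d k) = ennreal ((ell 0 / d k) powr (1 - s) * (6 * d k))"
        using d(1)[of k] by (intro ennreal_mult[symmetric]) auto
      also have "\<dots> \<le> ennreal (6 * ell 0 * d k powr s)"
      proof (intro ennreal_leI)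
        have "(ell 0 / d k) powr (1 - s) = ell 0 powr (1 - s) / d k powr (1 - s)" by (rule powr_divide)
        also have "d k powr (1 - s) = d k / d k powr s" using d(1)[of k] by (simp add: powr_diff)
        finally have "(ell 0 / d k) powr (1 - s) * (6 * d k) = 6 * ell 0 powr (1 - s) * d k powr s"
          using d(1)[of k] by (simp add: field_simps)
        also have "ell 0 powr (1 - s) \<le> ell 0 powr 1" using l1 s by (intro powr_mono) auto
        also have "ell 0 powr 1 = ell 0" using l1 by simp
        finally show "(ell 0 / d k) powr (1 - s) * (6 * d k) \<le> 6 * ell 0 * d k powr s"
          by (simp add: mult_right_mono)
      qed
      also have "\<dots> = ennreal (6 * ell 0) * ennreal (d k powr s)" using l1 by (intro ennreal_mult) auto
      finally show ?thesis .
    qed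
    then have "(\<Sum>k. \<integral>\<^sup>+x. ?B k x \<partial>lborel) \<le> (\<Sum>k. ennreal (6 * ell 0) * ennreal (d k powr s))"
      by (intro suminf_le summableI) auto
    also have "\<dots> = ennreal (6 * ell 0) * (\<Sum>k. ennreal (d k powr s))" by (rule ennreal_suminf_cmult)
    also have "\<dots> \<le> ennreal (6 * ell 0) * ennreal (1 / 48)" using d(3) by (intro mult_left_mono) auto
    also have "\<dots> = ennreal (6 * ell 0 * (1 / 48))" using l1 by (intro ennreal_mult[symmetric]) auto
    finally show "(\<Sum>k. \<integral>\<^sup>+x. ?B k x \<partial>lborel) \<le> ennreal (ell 0 / 8)" by simp
  qed
  also have "\<dots> = ennreal (ell 0 / 4)" using ell_pos[of 0] by (simp add: ennreal_plus[symmetric] del: ennreal_plus)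
  finally show ?thesis .
qed

text \<open>The average of the potential over the current interval stays at most
  \<open>1 / 4\<close>. A danger set or cover element not avoided would contain a whole interval in
  its enlarged version, with weight at least \<open>1 / 2\<close>.\<close>

lemma ex_avoiding_point: "\<exists>y. (\<forall>i. avoids i y) \<and> (\<forall>k. d k < \<bar>y - v k\<bar>)"
proof -
  have "0 < 1 / \<epsilon>" using eps by simp
  then obtain a where
    sub: "\<And>n. {a (Suc n)..a (Suc n) + ell (Suc n)} \<subseteq> {a n..a n + ell n}"
    and half: "\<And>n. 2 * (\<integral>\<^sup>+x\<in>{a (Suc n)..<a (Suc n) + ell (Suc n)}. pot n x \<partial>lborel)
      \<le> (\<integral>\<^sup>+x\<in>{a n..<a n + ell n}. pot n x \<partial>lborel)"
    using halving_sequence[of pot "1 / \<epsilon>", OF pot_measurable] unfolding ell_def by blast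
  define J where "J n = {a n..a n + ell n}" for n
  \<comment> \<open>This invariant and avoidance are proved together: avoidance at step
    \<open>n\<close> uses \<open>I m\<close> for \<open>m < n\<close>, and \<open>I n\<close> uses
    avoidance of the early levels.\<close>
  define I where "I n \<longleftrightarrow> (\<integral>\<^sup>+x\<in>{a n..<a n + ell n}. pot n x \<partial>lborel) \<le> ennreal (ell n / 4)" for n
  have nest: "J n \<subseteq> J m" if "m \<le> n" for m n
    by (rule lift_Suc_antimono_le[OF _ that]) (use sub in \<open>simp only: J_def\<close>)
  \<comment> \<open>The chosen half is compared with the old potential; the weights are updated
    afterwards.\<close>
  have half': "(\<integral>\<^sup>+x\<in>{a (Suc n)..<a (Suc n) + ell (Suc n)}. pot n x \<partial>lborel) \<le> ennreal (ell (Suc n) / 4)"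
    if "I n" for n
  proof -
    have "2 * (\<integral>\<^sup>+x\<in>{a (Suc n)..<a (Suc n) + ell (Suc n)}. pot n x \<partial>lborel) \<le> ennreal (ell n / 4)"
      using half[of n] that unfolding I_def by (rule order_trans)
    then have "(\<integral>\<^sup>+x\<in>{a (Suc n)..<a (Suc n) + ell (Suc n)}. pot n x \<partial>lborel) \<le> ennreal (ell n / 4 / 2)"
      by (rule ennreal_le_half) (use ell_pos[of n] in simp)
    also have "ell n / 4 / 2 = ell (Suc n) / 4" unfolding ell_Suc by simp
    finally show ?thesis .
  qed
  have avoid: "avoids i y" if I: "\<And>m. m < n \<Longrightarrow> I m" and le: "ell n \<le> rho i" and y: "y \<in> J n" for n i y
  proof -
    define t where "t = (LEAST n. ell n \<le> rho i)"
    have t: "ell t \<le> rho i" unfolding t_def using le by (rule LeastI)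
    have tn: "t \<le> n" unfolding t_def using le by (rule Least_le)
    \<comment> \<open>At step \<open>i\<close> the interval is still longer than
      \<open>rho i\<close>, so \<open>danger i\<close> has entered the potential before step
      \<open>t\<close>.\<close>
    have "\<not> t \<le> i" using ell_antimono[of t i] rho_less_ell[of i] t by linarith
    then obtain m where m: "t = Suc m" "i \<le> m" by (cases t) auto
    have "\<not> ell m \<le> rho i" using not_less_Least[of m "\<lambda>n. ell n \<le> rho i"] m unfolding t_def by auto
    then have om: "1 / 2 \<le> omega i m" using omega_ge_half[OF m(2)] by simp
    have yt: "y \<in> J t" using nest[OF tn] y by auto
    show ?thesis
    proof (rule ccontr)
      assume "\<not> avoids i y"
      then obtain z where z: "z \<in> point_centres i \<union> line_centres i" "\<bar>y - z\<bar> < rho i"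
        unfolding avoids_def by force
      have "ennreal (1 / 2) \<le> pot m x" if "x \<in> {a t..<a t + ell t}" for x
      proof -
        have "\<bar>x - y\<bar> \<le> ell t" using that yt unfolding J_def by auto
        then have "\<bar>z - x\<bar> < 2 * rho i" using z(2) t by linarith
        then have "x \<in> danger i" unfolding danger_def using z(1) by (auto simp: dist_real_def)
        then have "ennreal (omega i m) \<le> pot m x" using pot_ge_danger[OF m(2), of x] by simp
        then show ?thesis using om ennreal_leI order_trans by blast
      qed
      then have "ennreal (1 / 2 * ell t) \<le> (\<integral>\<^sup>+x\<in>{a t..<a t + ell t}. pot m x \<partial>lborel)"
        using ell_pos[of t] by (intro pot_integral_ge) auto
      also have "\<dots> \<le> ennreal (ell t / 4)" using half'[of m] I[of m] m tn by simp
      finally show False using ell_pos[of t] by simp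
    qed
  qed
  have I: "I n" for n
  proof (induction n rule: less_induct)
    case (less n)
    show ?case
    proof (cases n)
      case 0
      then show ?thesis unfolding I_def using pot_initial by simp
    next
      case (Suc m)
      define l where "l = ell n"
      have l0: "0 < l" unfolding l_def by (rule ell_pos)
      let ?J = "{a n..<a n + l}"
      have e: "0 \<le> 1 - eta m" using eta_bounds[of m] by simp
      have "(\<integral>\<^sup>+x\<in>?J. pot n x \<partial>lborel)
          \<le> (\<integral>\<^sup>+x. ennreal (1 - eta m) * (pot m x * indicator ?J x) + indicator (danger n \<inter> ?J) x \<partial>lborel)"
      proof (rule nn_integral_mono)
        fix x
        show "pot n x * indicator ?J x
            \<le> ennreal (1 - eta m) * (pot m x * indicator ?J x) + indicator (danger n \<inter> ?J) x"
          using pot_Suc[of m x] Suc by (cases "x \<in> ?J"; cases "x \<in> danger n") auto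
      qed
      also have "\<dots> = ennreal (1 - eta m) * (\<integral>\<^sup>+x\<in>?J. pot m x \<partial>lborel) + emeasure lborel (danger n \<inter> ?J)"
        by (subst nn_integral_add) (auto simp: nn_integral_cmult)
      also have "\<dots> \<le> ennreal (1 - eta m) * ennreal (l / 4) + ennreal (removal_const * \<epsilon> * l / lam n)"
      proof (intro add_mono mult_left_mono)
        show "(\<integral>\<^sup>+x\<in>?J. pot m x \<partial>lborel) \<le> ennreal (l / 4)"
          using half'[of m] less.IH[of m] Suc unfolding l_def by simp
        \<comment> \<open>The midpoint avoids all levels of radius at least \<open>l\<close>, as
          \<open>danger_measure\<close> demands.\<close>
        have "a n + l / 2 \<in> J n" using l0 unfolding J_def l_def[symmetric] by auto
        then show "emeasure lborel (danger n \<inter> ?J) \<le> ennreal (removal_const * \<epsilon> * l / lam n)"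
          using danger_measure[OF ell_pos level_conditions, of n "a n"] avoid[OF less.IH]
          unfolding l_def by blast
      qed auto
      also have "\<dots> = ennreal ((1 - eta m) * (l / 4) + removal_const * \<epsilon> * l / lam n)"
        using e l0 removal_const_ge_1 eps lam_ge_1[of n]
        by (subst ennreal_mult[symmetric]) (auto simp: ennreal_plus[symmetric] simp del: ennreal_plus)
      also have "\<dots> \<le> ennreal (l / 4)"
      proof (intro ennreal_leI)
        have "removal_const * \<epsilon> * l / lam n \<le> removal_const * \<epsilon> * l / lam m"
          using l0 removal_const_ge_1 eps lam_ge_1[of m] lam_mono[of m n] Suc
          by (intro divide_left_mono) auto
        \<comment> \<open>The new danger set costs less than what the decrease of the old weights
          saves.\<close>
        also have "\<dots> = eta m * l / 16" unfolding removal_eps eta_def using lam_ge_1[of m] by (simp add: field_simps)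
        also have "\<dots> \<le> eta m * l / 4" using l0 eta_bounds[of m] by simp
        finally have "removal_const * \<epsilon> * l / lam n \<le> eta m * l / 4" .
        moreover have "(1 - eta m) * (l / 4) = l / 4 - eta m * l / 4" by (simp add: field_simps)
        ultimately show "(1 - eta m) * (l / 4) + removal_const * \<epsilon> * l / lam n \<le> l / 4" by linarith
      qed
      finally show ?thesis unfolding I_def l_def .
    qed
  qed
  have "\<Inter> (range J) \<noteq> {}"
    by (rule compact_nest) (use nest ell_pos in \<open>auto simp: J_def less_imp_le\<close>)
  then obtain y where y: "\<And>n. y \<in> J n" by auto
  have "avoids i y" for i using ex_ell_le[OF rho_pos, of i] avoid[OF I] y by blast
  moreover have "d k < \<bar>y - v k\<bar>" for k
  proof (rule ccontr)
    assume near: "\<not> d k < \<bar>y - v k\<bar>"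
    obtain n0 where n0: "ell n0 \<le> d k" using ex_ell_le[OF d(1)] by blast
    define t where "t = (LEAST n. ell n \<le> d k)"
    have t: "ell t \<le> d k" unfolding t_def using n0 by (rule LeastI)
    \<comment> \<open>Since \<open>d k \<le> 1\<close>, the interval has a predecessor, which is
      longer than \<open>d k\<close>. So \<open>ell t\<close> lies between \<open>d k / 2\<close>
      and \<open>d k\<close>.\<close>
    have "1 < ell 0" unfolding ell_def using eps by (simp add: field_simps)
    then have "t \<noteq> 0" using t d(2)[of k] by (metis leD order_less_le_trans)
    then obtain m where m: "t = Suc m" by (cases t) auto
    have "\<not> ell m \<le> d k" using not_less_Least[of m "\<lambda>n. ell n \<le> d k"] m unfolding t_def by auto
    then have "1 / 2 \<le> ell t / d k" unfolding m ell_Suc using d(1)[of k] by (simp add: field_simps)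
    also have "ell t / d k = (ell t / d k) powr 1" using ell_pos[of t] d(1)[of k] by simp
    also have "\<dots> \<le> (ell t / d k) powr (1 - s)"
      using t ell_pos[of t] d(1)[of k] s by (intro powr_mono') auto
    finally have w: "1 / 2 \<le> (ell t / d k) powr (1 - s)" .
    have "ennreal (1 / 2) \<le> pot t x" if "x \<in> {a t..<a t + ell t}" for x
    proof -
      have "\<bar>x - y\<bar> \<le> ell t" using that y[of t] unfolding J_def by auto
      then have "\<bar>v k - x\<bar> < 3 * d k" using near t d(1)[of k] by linarith
      then have "x \<in> ball (v k) (3 * d k)" by (simp add: dist_real_def)
      then have "ennreal ((ell t / d k) powr (1 - s)) \<le> pot t x" using pot_ge_ball[of t k x] by simp
      then show ?thesis using w ennreal_leI order_trans by blast
    qed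
    then have "ennreal (1 / 2 * ell t) \<le> (\<integral>\<^sup>+x\<in>{a t..<a t + ell t}. pot t x \<partial>lborel)"
      using ell_pos[of t] by (intro pot_integral_ge) auto
    also have "\<dots> \<le> ennreal (ell t / 4)" using I[of t] unfolding I_def .
    finally show False using ell_pos[of t] by simp
  qed
  ultimately show ?thesis by blast
qed

end

section \<open>From avoidance to the sets Mad_P and Mad_L\<close>

text \<open>From \<open>2 ^ i \<le> N ^ 3\<close> follow \<open>i + 1 \<le> 7 * ln N\<close> and
  \<open>lam i \<le> 8 * ln (ln N)\<close>. For \<open>N \<ge> exp (exp 1)\<close> both occurrences
  of \<open>log_star\<close> are true logarithms.\<close>

lemma growth_le_log:
  assumes "exp (exp 1) \<le> N" "height_bd i \<le> N ^ 3"
  shows "growth i \<le> 56 * (log_star N * log_star (ln N))"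
proof -
  have N0: "0 < N" using assms(1) exp_gt_zero[of "exp 1 :: real"] by linarith
  have x: "exp 1 \<le> ln N" using assms(1) N0 by (simp add: ln_ge_iff)
  have e2: "2 \<le> exp (1::real)" using exp_ge_add_one_self[of "1::real"] by simp
  have x0: "0 < ln N" using x e2 by linarith
  have lx: "1 \<le> ln (ln N)" using x x0 by (simp add: ln_ge_iff)
  have "exp 1 \<le> exp (exp 1 :: real)" by simp
  then have "\<not> N < exp 1" using assms(1) by linarith
  then have ls: "log_star N = ln N" "log_star (ln N) = ln (ln N)" unfolding log_star_def using x by auto
  have "2 ^ i \<le> N ^ 3" using assms(2) power2_le_height_bd[of i] by linarith
  then have "ln (2 ^ i) \<le> ln (N ^ 3)" using N0 by (subst ln_le_cancel_iff) auto
  then have i1: "real i * ln 2 \<le> 3 * ln N" using N0 by (simp add: ln_realpow)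
  have ln2: "1 / 2 \<le> ln (2::real)" using ln_le_minus_one[of "1 / 2 :: real"] by (simp add: ln_div)
  have "real i * (1 / 2) \<le> real i * ln 2" using ln2 by (intro mult_left_mono) auto
  then have i7: "real i + 1 \<le> 7 * ln N" using i1 x e2 by linarith
  have "ln (real i + 1) \<le> ln (7 * ln N)" using i7 x0 by (subst ln_le_cancel_iff) auto
  also have "\<dots> = ln 7 + ln (ln N)" using x0 by (simp add: ln_mult)
  also have "ln (7::real) \<le> 6" using ln_le_minus_one[of "7::real"] by simp
  finally have "lam i \<le> 8 * ln (ln N)" unfolding lam_def using lx by simp
  then have "growth i \<le> (7 * ln N) * (8 * ln (ln N))"
    unfolding growth_def using i7 x0 lam_ge_1[of i] by (intro mult_mono) auto
  then show ?thesis unfolding ls by simp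
qed

context bad_line
begin

text \<open>For \<open>q \<ge> 1 / \<gamma>\<close> the height is at most \<open>q ^ 3\<close>, so
  \<open>growth\<close> at its level is at most \<open>56 * f q\<close>. Avoiding that level gives
  the lower bound \<open>\<epsilon> * \<gamma> / 56\<close>.\<close>

lemma avoids_all_Mad_P:
  assumes f: "\<And>q. f q = log_star q * log_star (ln q)" and av: "\<And>i. avoids i y"
  shows "(\<theta>, y) \<in> Mad_P f"
proof -
  define N0 where "N0 = nat \<lceil>max (exp (exp 1)) (1 / \<gamma>)\<rceil>"
  have main: "\<epsilon> * \<gamma> / 56 \<le> f (real q) * real q * int_dist (real q * \<theta>) * int_dist (real q * y)"
    if q: "q \<ge> N0" for q :: nat
  proof -
    have "max (exp (exp 1)) (1 / \<gamma>) \<le> real q" using q unfolding N0_def by linarith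
    then have q1: "exp (exp 1) \<le> real q" and q2: "1 / \<gamma> \<le> real q" by auto
    have q0: "0 < real q" using q1 exp_gt_zero[of "exp 1 :: real"] by linarith
    then have qn: "int q \<noteq> 0" by simp
    obtain i where i: "has_level (point_height (int q)) i"
      using height_bd_index[OF point_height_ge_1[OF qn]] unfolding has_level_def by blast
    define D where "D = int_dist (real q * \<theta>)"
    have H: "point_height (int q) = (real q)\<^sup>2 * D / \<gamma>" unfolding point_height_def D_def by simp
    have D0: "0 < D"
      using point_height_ge_1[OF qn] int_dist_nonneg[of "real q * \<theta>"] unfolding H D_def[symmetric]
      by (cases "D = 0") auto
    have "point_height (int q) \<le> (real q) ^ 3"
    proof -
      have "(real q)\<^sup>2 * D / \<gamma> = (real q)\<^sup>2 * (D * (1 / \<gamma>))" by simp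
      also have "\<dots> \<le> (real q)\<^sup>2 * (1 * real q)"
        using q2 D0 gamma int_dist_le_half[of "real q * \<theta>"] unfolding D_def[symmetric]
        by (intro mult_left_mono mult_mono) auto
      finally show ?thesis unfolding H by (simp add: power2_eq_square power3_eq_cube)
    qed
    then have "growth i \<le> 56 * f (real q)"
      unfolding f using i q1 unfolding has_level_def by (intro growth_le_log) auto
    moreover have "\<epsilon> * \<gamma> \<le> growth i * (real q * D * int_dist (real q * y))"
    proof -
      have "\<epsilon> / (growth i * point_height (int q)) * real q \<le> rho i * real q"
        using rho_ge[OF i, of i] by (intro mult_right_mono) auto
      also have "\<dots> \<le> int_dist (real q * y)"
        using avoids_point[OF i av qn, of "round (real q * y)"] unfolding int_dist_def by simp
      finally have le: "\<epsilon> / (growth i * ((real q)\<^sup>2 * D / \<gamma>)) * real q \<le> int_dist (real q * y)" unfolding H .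
      have *: "e * c \<le> g * (Q * d * E)" if "e / (g * (Q\<^sup>2 * d / c)) * Q \<le> E" "0 < g" "0 < Q" "0 < d" "0 < c"
        for e g Q d c E :: real
        using that by (simp add: field_simps power2_eq_square)
      show ?thesis by (rule *[OF le growth_pos q0 D0 gamma(1)])
    qed
    moreover have "0 \<le> real q * D * int_dist (real q * y)" using D0 int_dist_nonneg by simp
    ultimately have "\<epsilon> * \<gamma> \<le> 56 * f (real q) * (real q * D * int_dist (real q * y))"
      by (meson mult_right_mono order_trans)
    then show ?thesis unfolding D_def by (simp add: mult.assoc)
  qed
  have "ereal (\<epsilon> * \<gamma> / 56) \<le> liminf (\<lambda>q::nat. ereal (f (real q) * real q * int_dist (real q * \<theta>) * int_dist (real q * y)))"
    by (rule Liminf_bounded) (use main in \<open>auto simp: eventually_sequentially\<close>)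
  moreover have "0 < ereal (\<epsilon> * \<gamma> / 56)" using eps gamma by simp
  ultimately have "0 < liminf (\<lambda>q::nat. ereal (f (real q) * real q * int_dist (real q * \<theta>) * int_dist (real q * y)))"
    by (rule less_le_trans[rotated])
  then show ?thesis unfolding Mad_P_def by simp
qed

text \<open>As for points: the height \<open>\<bar>A\<bar> * B^2\<close> is at most the cube of
  \<open>\<bar>A * B\<bar>\<close>. A large product forces both factors to be nonzero, so
  \<open>abs_star\<close> is the absolute value.\<close>

lemma avoids_all_Mad_L:
  assumes f: "\<And>q. f q = log_star q * log_star (ln q)" and av: "\<And>i. avoids i y"
  shows "(\<theta>, y) \<in> Mad_L f"
proof -
  define N0 where "N0 = \<lceil>exp (exp 1) :: real\<rceil>"
  have main: "\<epsilon> / 56 \<le> f (abs_star (of_int A) * abs_star (of_int B)) * (abs_star (of_int A) * abs_star (of_int B))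
      * int_dist (of_int A * \<theta> - of_int B * y)"
    if AB: "N0 \<le> \<bar>A * B\<bar>" for A B :: int
  proof -
    define N where "N = \<bar>real_of_int A\<bar> * \<bar>real_of_int B\<bar>"
    have "real_of_int N0 \<le> real_of_int \<bar>A * B\<bar>" using AB of_int_le_iff by blast
    then have N1: "exp (exp 1) \<le> N" unfolding N0_def N_def by (simp add: abs_mult) linarith
    then have N0: "0 < N" using exp_gt_zero[of "exp 1 :: real"] by linarith
    then have A0: "A \<noteq> 0" and B0: "B \<noteq> 0" unfolding N_def by auto
    have st: "abs_star (of_int A) = \<bar>real_of_int A\<bar>" "abs_star (of_int B) = \<bar>real_of_int B\<bar>"
      unfolding abs_star_def using A0 B0 by linarith+
    have A1: "1 \<le> \<bar>real_of_int A\<bar>" and B1: "1 \<le> \<bar>real_of_int B\<bar>" using A0 B0 by linarith+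
    have H: "line_height A B = \<bar>real_of_int A\<bar> * \<bar>real_of_int B\<bar>\<^sup>2" unfolding line_height_def st by simp
    obtain i where i: "has_level (line_height A B) i"
      using height_bd_index[OF line_height_ge_1[OF B0]] unfolding has_level_def by blast
    have "line_height A B \<le> N ^ 3"
    proof -
      have "\<bar>real_of_int A\<bar> ^ 1 * \<bar>real_of_int B\<bar> ^ 2 \<le> \<bar>real_of_int A\<bar> ^ 3 * \<bar>real_of_int B\<bar> ^ 3"
        using A1 B1 by (intro mult_mono power_increasing) auto
      then show ?thesis unfolding H N_def by (simp add: power_mult_distrib)
    qed
    then have "growth i \<le> 56 * f N"
      unfolding f using i N1 unfolding has_level_def by (intro growth_le_log) auto
    moreover have "\<epsilon> \<le> growth i * (N * int_dist (of_int A * \<theta> - of_int B * y))"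
    proof -
      define E where "E = int_dist (of_int A * \<theta> - of_int B * y)"
      have "\<epsilon> / (growth i * line_height A B) * \<bar>real_of_int B\<bar> \<le> rho i * \<bar>real_of_int B\<bar>"
        using rho_ge[OF i, of i] by (intro mult_right_mono) auto
      also have "\<dots> \<le> E"
        using avoids_line[OF i av B0, of "- round (of_int A * \<theta> - of_int B * y)"]
        unfolding E_def int_dist_def by simp
      finally have le: "\<epsilon> / (growth i * (\<bar>real_of_int A\<bar> * \<bar>real_of_int B\<bar>\<^sup>2)) * \<bar>real_of_int B\<bar> \<le> E" unfolding H .
      have *: "e \<le> g * (a * b * E)" if "e / (g * (a * b\<^sup>2)) * b \<le> E" "0 < g" "0 < a" "0 < b"
        for e g a b E :: real
        using that by (simp add: field_simps power2_eq_square)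
      show ?thesis unfolding N_def E_def[symmetric]
        by (rule *[OF le growth_pos]) (use A0 B0 in auto)
    qed
    moreover have "0 \<le> N * int_dist (of_int A * \<theta> - of_int B * y)" using N0 int_dist_nonneg by simp
    ultimately have "\<epsilon> \<le> 56 * f N * (N * int_dist (of_int A * \<theta> - of_int B * y))"
      by (meson mult_right_mono order_trans)
    then show ?thesis unfolding st N_def[symmetric] by (simp add: mult.assoc)
  qed
  have "ereal (\<epsilon> / 56) \<le> Liminf prod_at_infinity (\<lambda>(A, B).
      ereal (f (abs_star (of_int A) * abs_star (of_int B)) *
        (abs_star (of_int A) * abs_star (of_int B)) * int_dist (of_int A * \<theta> - of_int B * y)))"
    by (rule Liminf_bounded, unfold prod_at_infinity_def eventually_filtercomap_at_top_linorder)
      (use main in \<open>auto intro!: exI[of _ N0]\<close>)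
  moreover have "0 < ereal (\<epsilon> / 56)" using eps by simp
  ultimately have "0 < Liminf prod_at_infinity (\<lambda>(A, B).
      ereal (f (abs_star (of_int A) * abs_star (of_int B)) *
        (abs_star (of_int A) * abs_star (of_int B)) * int_dist (of_int A * \<theta> - of_int B * y)))"
    by (rule less_le_trans[rotated])
  then show ?thesis unfolding Mad_L_def by simp
qed

end

section \<open>Positive measure below dimension one\<close>

text \<open>\<open>1 / \<epsilon>\<close> will be \<open>32 * C * (M + 1)\<close>, so its square is
  eventually below \<open>2 ^ M\<close>; and \<open>2 powr (s - 1) < 1\<close> leaves room for
  \<open>1 / (2 * (M + 1))\<close>.\<close>

lemma ex_large_exponent:
  fixes C s :: real
  assumes "1 \<le> C" "s < 1"
  shows "\<exists>M::nat. 8 \<le> M \<and> (32 * C * (real M + 1))\<^sup>2 \<le> 2 ^ M \<and> 2 powr (s - 1) \<le> 1 - 1 / (2 * (real M + 1))"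
proof -
  have lim1: "(\<lambda>n. real n * (1 / sqrt 2) ^ n) \<longlonglongrightarrow> 0"
    by (rule powser_times_n_limit_0) simp
  have "eventually (\<lambda>n. real n * (1 / sqrt 2) ^ n < 1 / (64 * C)) sequentially"
    using assms by (intro order_tendstoD(2)[OF lim1]) auto
  moreover have "(\<lambda>n. 1 / (2 * (real n + 1))) \<longlonglongrightarrow> 0"
    using tendsto_mult_right_zero[OF LIMSEQ_inverse_real_of_nat, of "1 / 2"] by (simp add: field_simps)
  then have "eventually (\<lambda>n. 1 / (2 * (real n + 1)) < 1 - 2 powr (s - 1)) sequentially"
    using assms by (intro order_tendstoD(2)) (auto simp: powr_less_one)
  moreover have "eventually (\<lambda>n::nat. 8 \<le> n) sequentially" by (rule eventually_ge_at_top)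
  ultimately have "eventually (\<lambda>n. 8 \<le> n \<and> real n * (1 / sqrt 2) ^ n < 1 / (64 * C)
      \<and> 1 / (2 * (real n + 1)) < 1 - 2 powr (s - 1)) sequentially"
    by eventually_elim auto
  then obtain M where M: "8 \<le> M" "real M * (1 / sqrt 2) ^ M < 1 / (64 * C)"
    "1 / (2 * (real M + 1)) < 1 - 2 powr (s - 1)"
    by (auto simp: eventually_sequentially)
  have "64 * C * real M < sqrt 2 ^ M" using M(2) assms by (simp add: field_simps power_divide)
  moreover have "32 * C * (real M + 1) \<le> 64 * C * real M" using M(1) assms by (simp add: field_simps)
  ultimately have "32 * C * (real M + 1) \<le> sqrt 2 ^ M" by linarith
  then have "(32 * C * (real M + 1))\<^sup>2 \<le> (sqrt 2 ^ M)\<^sup>2" using assms by (intro power_mono) auto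
  also have "\<dots> = ((sqrt 2)\<^sup>2) ^ M" by (metis mult.commute power_mult)
  also have "\<dots> = 2 ^ M" by simp
  finally show ?thesis using M by (intro exI[of _ M]) auto
qed

text \<open>Measure zero would give a cover with small sum of \<open>diam powr s\<close>. Each
  element meets the line in a set within \<open>d k\<close> of some \<open>v k\<close>, and the
  point found by the removal process lies in none of them.\<close>

lemma Mad_hausdorff_measure_nonzero:
  assumes f: "\<And>q. f q = log_star q * log_star (ln q)" and th: "badly_approximable \<theta>"
    and s: "0 < s" "s < 1"
  shows "hausdorff_measure s (Mad_P f \<inter> Mad_L f \<inter> vertical_line \<theta>) \<noteq> 0"
proof
  let ?E = "Mad_P f \<inter> Mad_L f \<inter> vertical_line \<theta>"
  assume zero: "hausdorff_measure s ?E = 0"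
  have "hausdorff_premeasure s 1 ?E \<le> hausdorff_measure s ?E"
    unfolding hausdorff_measure_def by (rule SUP_upper) simp
  then have "hausdorff_premeasure s 1 ?E < ennreal (1 / 96)" using zero by simp
  then obtain U :: "nat \<Rightarrow> (real \<times> real) set" where U: "?E \<subseteq> (\<Union>i. U i)" "\<And>i. bounded (U i)"
    and sum: "(\<Sum>i. hausdorff_gauge s (U i)) < ennreal (1 / 96)"
    unfolding hausdorff_premeasure_def Inf_less_iff by blast
  \<comment> \<open>Keeps \<open>d k\<close> positive where the diameter is zero, at a total cost of
    \<open>1 / 96\<close>.\<close>
  define e where "e k = 1 / 96 * (1 / 2 :: real) ^ Suc k" for k
  define d where "d k = (diameter (U k) powr s + e k) powr (1 / s)" for k
  have e0: "0 < e k" for k unfolding e_def by simp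
  have ds: "d k powr s = diameter (U k) powr s + e k" for k
    unfolding d_def powr_powr
    using s add_nonneg_pos[OF powr_ge_zero e0[of k], of "diameter (U k)" s] by simp
  have d0: "0 < d k" for k
    unfolding d_def using add_nonneg_pos[OF powr_ge_zero e0[of k], of "diameter (U k)" s] by simp
  have diam: "diameter (U k) \<le> d k" for k
  proof -
    have "diameter (U k) = (diameter (U k) powr s) powr (1 / s)"
      using s diameter_ge_0[OF U(2)] by (simp add: powr_powr)
    also have "\<dots> \<le> d k" unfolding d_def using s e0[of k] by (intro powr_mono2) auto
    finally show ?thesis .
  qed
  have gauge: "hausdorff_gauge s (U k) = ennreal (diameter (U k) powr s)" for k
    unfolding hausdorff_gauge_def using s by auto
  have "e sums (1 / 96 * 1)" unfolding e_def by (rule sums_mult[OF power_half_series])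
  then have "(\<Sum>k. ennreal (e k)) = ennreal (1 / 96 * 1)"
    by (rule suminf_ennreal_eq[OF less_imp_le[OF e0]])
  then have esum: "(\<Sum>k. ennreal (e k)) = ennreal (1 / 96)" by (simp only: mult_1_right)
  have "(\<Sum>k. ennreal (d k powr s)) = (\<Sum>k. hausdorff_gauge s (U k) + ennreal (e k))"
    unfolding ds gauge ennreal_plus[OF powr_ge_zero less_imp_le[OF e0]] ..
  also have "\<dots> = (\<Sum>k. hausdorff_gauge s (U k)) + (\<Sum>k. ennreal (e k))"
    by (rule suminf_add[symmetric]) (rule summableI)+
  also have "\<dots> \<le> ennreal (1 / 96) + ennreal (1 / 96)"
    unfolding esum by (rule add_right_mono[OF less_imp_le[OF sum]])
  also have "\<dots> = ennreal (1 / 48)" by (subst ennreal_plus[symmetric]) simp_all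
  finally have dsum: "(\<Sum>k. ennreal (d k powr s)) \<le> ennreal (1 / 48)" .
  have d1: "d k \<le> 1" for k
  proof (rule ccontr)
    assume "\<not> d k \<le> 1"
    then have "1 \<le> d k powr s" using s by (intro ge_one_powr_ge_zero) auto
    then have "ennreal 1 \<le> ennreal (d k powr s)" by (rule ennreal_leI)
    also have "\<dots> = (\<Sum>k\<in>{k}. ennreal (d k powr s))" by simp
    also have "\<dots> \<le> (\<Sum>k. ennreal (d k powr s))" by (rule sum_le_suminf) (auto intro: summableI)
    also have "\<dots> \<le> ennreal (1 / 48)" by (rule dsum)
    finally show False by (simp add: ennreal_le_iff)
  qed
  \<comment> \<open>The ordinate of some point of \<open>U k\<close> on the line; it is arbitrary if
    \<open>U k\<close> misses the line.\<close>
  define v where "v k = (SOME y. (\<theta>, y) \<in> U k)" for k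
  have v: "\<bar>y - v k\<bar> \<le> d k" if "(\<theta>, y) \<in> U k" for y k
  proof -
    have "(\<theta>, v k) \<in> U k" unfolding v_def using that by (rule someI)
    then have "dist (\<theta>, y) (\<theta>, v k) \<le> diameter (U k)" using diameter_bounded_bound[OF U(2)] that by blast
    then show ?thesis using diam[of k] by (simp add: dist_Pair_Pair dist_real_def)
  qed
  obtain \<gamma> where g: "0 < \<gamma>" "\<gamma> \<le> 1 / 2"
    "\<And>a c :: int. a \<noteq> 0 \<Longrightarrow> \<gamma> \<le> \<bar>real_of_int a\<bar> * \<bar>a * \<theta> - c\<bar>"
    using badly_approximable_uniform[OF th] by blast
  define C where "C = 24 * (1025 + 128 / \<gamma>)"
  have "1 * 1 \<le> 24 * (1025 + 128 / \<gamma>)" using g(1) by (intro mult_mono) auto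
  then have C1: "1 \<le> C" unfolding C_def by simp
  obtain M :: nat where M: "8 \<le> M" "(32 * C * (real M + 1))\<^sup>2 \<le> 2 ^ M"
    "2 powr (s - 1) \<le> 1 - 1 / (2 * (real M + 1))"
    using ex_large_exponent[OF C1 s(2)] by blast
  define \<epsilon> where "\<epsilon> = 1 / (32 * C * (real M + 1))"
  have "4 * 1 * 1 \<le> 32 * C * (real M + 1)" using C1 by (intro mult_mono) auto
  then have W: "4 \<le> 32 * C * (real M + 1)" by simp
  have eps: "0 < \<epsilon>" "\<epsilon> \<le> 1 / 4"
    unfolding \<epsilon>_def using W divide_left_mono[OF W, of 1] by simp_all
  interpret bad_line \<theta> \<gamma> \<epsilon>
    by unfold_locales (rule g(1), rule g(2), erule g(3), rule eps(1), rule eps(2))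
  have C: "removal_const = C" unfolding removal_const_def C_def ..
  interpret removal \<theta> \<gamma> \<epsilon> M s d v
  proof
    show "1 / \<epsilon> = 32 * removal_const * (real M + 1)" unfolding C \<epsilon>_def by simp
    show "(1 / \<epsilon>)\<^sup>2 \<le> 2 ^ M" unfolding \<epsilon>_def using M(2) by simp
  qed (use s M d0 d1 dsum in simp_all)
  obtain y where y: "\<And>i. avoids i y" "\<And>k. d k < \<bar>y - v k\<bar>" using ex_avoiding_point by blast
  have "(\<theta>, y) \<in> ?E"
    using avoids_all_Mad_P[OF f y(1)] avoids_all_Mad_L[OF f y(1)] unfolding vertical_line_def by blast
  then obtain k where "(\<theta>, y) \<in> U k" using U(1) by blast
  then show False using v[of y k] y(2)[of k] by simp
qed

section \<open>Upper bound and the dimension\<close>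

text \<open>The unbounded line is covered at once by intervals of lengths
  \<open>c / (n + 1)\<close>: the harmonic series diverges, so they reach every point, while the sum
  of their powers converges for \<open>s > 1\<close> and scales with
  \<open>c powr s\<close>.\<close>

lemma hausdorff_measure_vertical_line:
  assumes E: "E \<subseteq> vertical_line \<theta>" and s: "1 < s"
  shows "hausdorff_measure s E = 0"
proof -
  define K where "K = (\<Sum>i. (2 / (real i + 1)) powr s)"
  have summ: "summable (\<lambda>i. (2 / (real i + 1)) powr s)"
  proof -
    have "summable (\<lambda>i. real (Suc i) powr (- s))"
      by (subst summable_Suc_iff) (use s in \<open>simp add: summable_real_powr_iff\<close>)
    then have "summable (\<lambda>i. 2 powr s * real (Suc i) powr (- s))" by (rule summable_mult)
    moreover have "(2 / (real i + 1)) powr s = 2 powr s * real (Suc i) powr (- s)" for i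
      by (simp add: powr_divide powr_minus_divide add.commute)
    ultimately show ?thesis by simp
  qed
  have K0: "0 \<le> K" unfolding K_def by (intro suminf_nonneg summ) auto
  have bound: "hausdorff_premeasure s \<delta> E \<le> ennreal (c powr s * K)" if c: "0 < c" "c \<le> \<delta>" for c \<delta>
  proof -
    \<comment> \<open>Even indices run up the line, odd ones down.\<close>
    define sg :: "nat \<Rightarrow> real" where "sg i = (if even i then 1 else - 1)" for i
    define U where "U i = (\<lambda>t. (\<theta>, sg i * t)) ` {c * harm (i div 2)..c * harm (Suc (i div 2))}" for i :: nat
    have len: "c * harm (Suc n) - c * harm n = c / (real n + 1)" for n
      by (simp add: harm_Suc algebra_simps inverse_eq_divide)
    have diam: "diameter (U i) \<le> c / (real (i div 2) + 1)" for i
    proof (rule diameter_le)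
      show "U i \<noteq> {} \<or> 0 \<le> c / (real (i div 2) + 1)" using c by simp
      fix p q assume "p \<in> U i" "q \<in> U i"
      then obtain t u where tu: "p = (\<theta>, sg i * t)" "q = (\<theta>, sg i * u)"
        "t \<in> {c * harm (i div 2)..c * harm (Suc (i div 2))}" "u \<in> {c * harm (i div 2)..c * harm (Suc (i div 2))}"
        unfolding U_def by blast
      have "norm (p - q) = \<bar>sg i * (t - u)\<bar>" unfolding tu(1,2) by (simp add: norm_Pair right_diff_distrib)
      also have "\<dots> = \<bar>t - u\<bar>" unfolding sg_def by (simp add: abs_minus_commute)
      also have "\<dots> \<le> c * harm (Suc (i div 2)) - c * harm (i div 2)" using tu(3,4) by auto
      finally show "norm (p - q) \<le> c / (real (i div 2) + 1)" unfolding len .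
    qed
    have bdd: "bounded (U i)" for i
      unfolding U_def by (intro compact_imp_bounded compact_continuous_image continuous_intros) auto
    have cover: "(\<theta>, y) \<in> (\<Union>i. U i)" for y
    proof -
      obtain n where n: "\<bar>y\<bar> < c * harm n"
      proof -
        have "eventually (\<lambda>n. \<bar>y\<bar> / c < harm n) sequentially"
          using harm_at_top by (simp add: filterlim_at_top_dense)
        then obtain n where "\<bar>y\<bar> / c < harm n" by (auto simp: eventually_sequentially)
        then show thesis using that[of n] c by (simp add: field_simps)
      qed
      define m where "m = (LEAST n. \<bar>y\<bar> < c * harm n)"
      have m: "\<bar>y\<bar> < c * harm m" unfolding m_def using n by (rule LeastI)
      then have "m \<noteq> 0" by (auto simp: harm_def intro: ccontr)
      then obtain k where k: "m = Suc k" by (cases m) auto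
      have "\<not> \<bar>y\<bar> < c * harm k" using not_less_Least[of k "\<lambda>n. \<bar>y\<bar> < c * harm n"] k unfolding m_def by auto
      then have mem: "\<bar>y\<bar> \<in> {c * harm k..c * harm (Suc k)}" using m k by auto
      show ?thesis
      proof (cases "0 \<le> y")
        case True
        then have "(\<theta>, y) \<in> U (2 * k)" unfolding U_def sg_def using mem by (auto intro!: image_eqI[of _ _ "\<bar>y\<bar>"])
        then show ?thesis by blast
      next
        case False
        then have "(\<theta>, y) \<in> U (2 * k + 1)" unfolding U_def sg_def using mem by (auto intro!: image_eqI[of _ _ "\<bar>y\<bar>"])
        then show ?thesis by blast
      qed
    qed
    have "hausdorff_premeasure s \<delta> E \<le> (\<Sum>i. hausdorff_gauge s (U i))"
      unfolding hausdorff_premeasure_def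
    proof (intro Inf_lower CollectI exI[of _ U] conjI allI refl)
      show "E \<subseteq> (\<Union>i. U i)" using E cover unfolding vertical_line_def by auto
      fix i
      show "bounded (U i)" by (rule bdd)
      have "c / (real (i div 2) + 1) \<le> c" using c by (simp add: field_simps)
      then show "diameter (U i) \<le> \<delta>" using diam[of i] c by linarith
    qed
    also have "\<dots> \<le> (\<Sum>i. ennreal (c powr s * (2 / (real i + 1)) powr s))"
    proof (intro suminf_le summableI)
      fix i
      \<comment> \<open>Each length occurs for two indices; this bound replaces it by a single
        series in \<open>i\<close>.\<close>
      have "real (i + 1) \<le> real (2 * (i div 2 + 1))" by (subst of_nat_le_iff) presburger
      then have "1 / (real (i div 2) + 1) \<le> 2 / (real i + 1)" by (simp add: field_simps)
      then have "c * (1 / (real (i div 2) + 1)) \<le> c * (2 / (real i + 1))" using c by (intro mult_left_mono) auto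
      then have "c / (real (i div 2) + 1) \<le> c * (2 / (real i + 1))" by simp
      then have "diameter (U i) powr s \<le> (c * (2 / (real i + 1))) powr s"
        using diam[of i] diameter_ge_0[OF bdd, of i] s by (intro powr_mono2) auto
      also have "\<dots> = c powr s * (2 / (real i + 1)) powr s" by (rule powr_mult)
      finally show "hausdorff_gauge s (U i) \<le> ennreal (c powr s * (2 / (real i + 1)) powr s)"
        unfolding hausdorff_gauge_def using s by (auto intro: ennreal_leI)
    qed
    also have "\<dots> = ennreal (\<Sum>i. c powr s * (2 / (real i + 1)) powr s)"
      by (intro suminf_ennreal2 summable_mult summ) auto
    also have "(\<Sum>i. c powr s * (2 / (real i + 1)) powr s) = c powr s * K"
      unfolding K_def by (rule suminf_mult[OF summ])
    finally show ?thesis .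
  qed
  have "hausdorff_premeasure s \<delta> E = 0" if \<delta>: "0 < \<delta>" for \<delta>
  proof -
    have "hausdorff_premeasure s \<delta> E \<le> 0 + ennreal e" if e: "0 < e" for e
    proof -
      \<comment> \<open>Fine enough for \<open>\<delta>\<close>, and small enough for
        \<open>c powr s * K \<le> e\<close>; \<open>K + 1\<close> avoids division by zero.\<close>
      define c where "c = min \<delta> ((e / (K + 1)) powr (1 / s))"
      have c: "0 < c" "c \<le> \<delta>" unfolding c_def using \<delta> e K0 by auto
      have "c powr s \<le> ((e / (K + 1)) powr (1 / s)) powr s"
        using c s by (intro powr_mono2) (auto simp: c_def)
      also have "\<dots> = e / (K + 1)" using s e K0 by (simp add: powr_powr)
      finally have "c powr s * K \<le> e / (K + 1) * K" using K0 by (rule mult_right_mono)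
      also have "\<dots> \<le> e" using e K0 by (simp add: field_simps)
      finally show ?thesis using bound[OF c] by (simp add: ennreal_leI order_trans)
    qed
    then have "hausdorff_premeasure s \<delta> E \<le> 0" by (rule ennreal_le_epsilon)
    then show ?thesis by simp
  qed
  then show ?thesis unfolding hausdorff_measure_def by simp
qed

lemma hausdorff_measure_empty:
  assumes "0 < s"
  shows "hausdorff_measure s ({} :: 'a::metric_space set) = 0"
proof -
  have "hausdorff_premeasure s \<delta> ({} :: 'a set) = 0" if "0 < \<delta>" for \<delta>
  proof -
    have "hausdorff_premeasure s \<delta> ({} :: 'a set) \<le> (\<Sum>i::nat. hausdorff_gauge s ({} :: 'a set))"
      unfolding hausdorff_premeasure_def
      by (intro Inf_lower CollectI exI[of _ "\<lambda>_. {}"]) (use that in auto)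
    then show ?thesis by (simp add: hausdorff_gauge_def)
  qed
  then show ?thesis unfolding hausdorff_measure_def by simp
qed

text \<open>With exponent 0 a nonempty covering set already contributes \<open>1\<close>.\<close>

lemma hausdorff_measure_0_nonzero:
  assumes "E \<noteq> {}"
  shows "hausdorff_measure 0 E \<noteq> 0"
proof
  assume zero: "hausdorff_measure 0 E = 0"
  have "hausdorff_premeasure 0 1 E \<le> hausdorff_measure 0 E"
    unfolding hausdorff_measure_def by (rule SUP_upper) simp
  then have "hausdorff_premeasure 0 1 E < 1" using zero by simp
  then obtain U where U: "E \<subseteq> (\<Union>i::nat. U i)" and sum: "(\<Sum>i. hausdorff_gauge 0 (U i)) < 1"
    unfolding hausdorff_premeasure_def Inf_less_iff by auto
  obtain k where "U k \<noteq> {}" using assms U by fastforce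
  then have "1 = (\<Sum>i\<in>{k}. hausdorff_gauge 0 (U i))" by (simp add: hausdorff_gauge_def)
  also have "\<dots> \<le> (\<Sum>i. hausdorff_gauge 0 (U i))" by (rule sum_le_suminf) (auto intro: summableI)
  finally show False using sum by simp
qed

theorem theorem2:
  fixes f :: "real \<Rightarrow> real" and \<theta> :: real
  assumes "\<And>q. f q = log_star q * log_star (ln q)"
    and "badly_approximable \<theta>"
  shows "hausdorff_dim (Mad_P f \<inter> Mad_L f \<inter> vertical_line \<theta>) = 1"
proof (rule antisym)
  let ?E = "Mad_P f \<inter> Mad_L f \<inter> vertical_line \<theta>"
  have "hausdorff_dim ?E \<le> 1 + ennreal e" if "0 < e" for e
  proof -
    have "hausdorff_measure (1 + e) ?E = 0" using that by (intro hausdorff_measure_vertical_line) auto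
    then have "hausdorff_dim ?E \<le> ennreal (1 + e)"
      unfolding hausdorff_dim_def using that by (intro Inf_lower CollectI exI[of _ "1 + e"]) auto
    then show ?thesis using that by simp
  qed
  then show "hausdorff_dim ?E \<le> 1" by (rule ennreal_le_epsilon)
  show "1 \<le> hausdorff_dim ?E"
    unfolding hausdorff_dim_def
  proof (rule Inf_greatest, clarify)
    fix s :: real assume s: "0 \<le> s" "hausdorff_measure s ?E = 0"
    note pos = Mad_hausdorff_measure_nonzero[OF assms]
    \<comment> \<open>Positive measure for \<open>s = 1 / 2\<close> provides a point of the set, on
      which the case \<open>s = 0\<close> rests.\<close>
    have "?E \<noteq> {}" using pos[of "1 / 2"] hausdorff_measure_empty[of "1 / 2"] by auto
    then have "s \<noteq> 0" using hausdorff_measure_0_nonzero[of ?E] s by auto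
    then have "1 \<le> s" using pos[of s] s by force
    then show "1 \<le> ennreal s" by simp
  qed
qed

end
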